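(* Let $G$ be a real Lie group, $E$ a countable set with a coding map $E\to G$, $e\mapsto g_e$, and assume given a Markov chain on $E$ that is irreducible and recurrent. Let $e,e'\in E$. (i) Let $c\in E^*$ be $(e'{\leftarrow}e)$-admissible and $c'\in E^*$ be $(e{\leftarrow}e')$-admissible. Then the semigroups $G_e^+$ and $G_{e'}^+$ satisfy $g_{c'}G_{e'}^+g_c\subset G_e^+$. If $G$ is real algebraic, we additionally have the following. (ii) The groups $H_e$ and $H_{e'}$ are conjugate inside $H_{\mathcal{S}}$. More precisely, with $c,c'$ as in (i) we have $g_{c'}H_{e'}g_{c'}^{-1}=g_c^{-1}H_{e'}g_c=H_e$. (iii) If there exists $\tilde e\in E$ with both words $e\tilde e$ and $e'\tilde e$ admissible, then $H_e=H_{e'}$. (iv) If there exists $\tilde e\in E$ with $f\tilde e$ admissible for all $f\in E$, then all $H_f$, $f\in E$, coincide and $H_{\mathcal{S}}$ is contained in their normalizer. (v) If there exists $\tilde e\in E$ with $\tilde ef$ admissible for all $f\in E$, then $H_f=H_{\mathcal{S}}$ for all $f\in E$. In particular, $H_{\mathcal{S}}$ is a group.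
   Context: Markov chain notation: $p_{e',e}$ is the probability of going from state $e$ to state $e'$; $\mathbb{P}_e$ is the Markov measure on $E^{\mathbb{N}}$ (indices from $0$) started at $\omega_0=e$; $\tau_e(\omega)=\inf\{n\ge1:\omega_n=e\}$. Irreducible: $\mathbb{P}_e[\tau_{e'}<\infty]>0$ for all $e,e'$. Recurrent: $\mathbb{P}_e[\tau_e<\infty]=1$ for all $e$. $E^*$ is the set of finite words over $E$, written right to left: for $w=e_{n-1}\ldots e_0$, $g_w=g_{e_{n-1}}\cdots g_{e_0}$. A non-empty word $w=e_{n-1}\ldots e_0$ is $(e'{\leftarrow}e)$-admissible if $e_0=e$, $p_{e_k,e_{k-1}}>0$ for $1\le k\le n-1$, and $p_{e',e_{n-1}}>0$; it is admissible if it is $(e'{\leftarrow}e)$-admissible for some $e,e'\in E$. The renewal measure $\mu_e$ is the law on $G$ of $g_{\omega_{\tau_e-1}}\cdots g_{\omega_0}$ under $\mathbb{P}_e$. $G_e^+$ is the closed subsemigroup of $G$ generated by $\operatorname{supp}(\mu_e)$. $G_{\mathcal{S}}=\{g_w: w\in E^*\text{ admissible}\}$ (in general not closed under multiplication). When $G$ is real algebraic, $H_e$ and $H_{\mathcal{S}}$ are the Zariski closures in $G$ of $G_e^+$ and $G_{\mathcal{S}}$, respectively (each $H_e$ is a group). *)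

theory Defs
  imports "HOL-Probability.Probability" "HOL-Algebra.Group_Action"
begin

section \<open>Real Lie groups\<close>

text \<open>\<open>Ck_on n S k f\<close>: all partial derivatives of \<open>f\<close> up to order \<open>k\<close> exist and are continuous on
  \<open>S\<close>, an open subset of \<open>Euclidean_space n\<close>. The model spaces are \<open>Euclidean_space n\<close> rather than a
  type of class \<open>euclidean_space\<close> because the latter has positive dimension, whereas \<open>n = 0\<close>
  (discrete groups) must be allowed. Only the germ of \<open>f\<close> along \<open>S\<close> matters, since \<open>x(i := t) \<in> S\<close>
  for \<open>x \<in> S\<close>, \<open>i < n\<close> and \<open>t\<close> near \<open>x i\<close>.\<close>

primrec Ck_on :: "nat \<Rightarrow> (nat \<Rightarrow> real) set \<Rightarrow> nat \<Rightarrow> ((nat \<Rightarrow> real) \<Rightarrow> real) \<Rightarrow> bool" where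
  "Ck_on n S 0 f \<longleftrightarrow> continuous_map (subtopology (Euclidean_space n) S) euclideanreal f"
| "Ck_on n S (Suc k) f \<longleftrightarrow>
     continuous_map (subtopology (Euclidean_space n) S) euclideanreal f \<and>
     (\<forall>i<n. (\<forall>x\<in>S. (\<lambda>t. f (x(i := t))) differentiable (at (x i))) \<and>
            Ck_on n S k (\<lambda>x. deriv (\<lambda>t. f (x(i := t))) (x i)))"

definition smooth_on :: "nat \<Rightarrow> (nat \<Rightarrow> real) set \<Rightarrow> ((nat \<Rightarrow> real) \<Rightarrow> real) \<Rightarrow> bool" where
  "smooth_on n S f \<longleftrightarrow> (\<forall>k. Ck_on n S k f)"

text \<open>A chart is a pair of its domain and its coordinate map.\<close>

type_synonym 'a atlas = "('a set \<times> ('a \<Rightarrow> nat \<Rightarrow> real)) set"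

definition smooth_manifold :: "'a topology \<Rightarrow> nat \<Rightarrow> 'a atlas \<Rightarrow> bool" where
  "smooth_manifold T n A \<longleftrightarrow>
     Hausdorff_space T \<and> second_countable T \<and>
     (\<forall>(U, \<phi>)\<in>A. openin T U \<and> openin (Euclidean_space n) (\<phi> ` U) \<and>
        homeomorphic_map (subtopology T U) (subtopology (Euclidean_space n) (\<phi> ` U)) \<phi>) \<and>
     (\<Union>(U, \<phi>)\<in>A. U) = topspace T \<and>
     (\<forall>(U, \<phi>)\<in>A. \<forall>(V, \<psi>)\<in>A. \<forall>i<n.
        smooth_on n (\<phi> ` (U \<inter> V)) (\<lambda>z. \<psi> (inv_into U \<phi> z) i))"

definition smooth_map ::
  "'a topology \<Rightarrow> nat \<Rightarrow> 'a atlas \<Rightarrow> 'b topology \<Rightarrow> nat \<Rightarrow> 'b atlas \<Rightarrow> ('a \<Rightarrow> 'b) \<Rightarrow> bool" where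
  "smooth_map T n A T' m B f \<longleftrightarrow>
     continuous_map T T' f \<and>
     (\<forall>(U, \<phi>)\<in>A. \<forall>(V, \<psi>)\<in>B. \<forall>i<m.
        smooth_on n (\<phi> ` {x\<in>U. f x \<in> V}) (\<lambda>z. \<psi> (f (inv_into U \<phi> z)) i))"

definition prod_chart ::
  "nat \<Rightarrow> ('a \<Rightarrow> nat \<Rightarrow> real) \<Rightarrow> ('b \<Rightarrow> nat \<Rightarrow> real) \<Rightarrow> 'a \<times> 'b \<Rightarrow> nat \<Rightarrow> real" where
  "prod_chart n \<phi> \<psi> = (\<lambda>(x, y) i. if i < n then \<phi> x i else \<psi> y (i - n))"

definition prod_atlas :: "nat \<Rightarrow> 'a atlas \<Rightarrow> 'b atlas \<Rightarrow> ('a \<times> 'b) atlas" where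
  "prod_atlas n A B = {(U \<times> V, prod_chart n \<phi> \<psi>) | U \<phi> V \<psi>. (U, \<phi>) \<in> A \<and> (V, \<psi>) \<in> B}"

locale lie_group = group G for G :: "('a, 'b) monoid_scheme" (structure) +
  fixes T :: "'a topology" and n :: nat and A :: "'a atlas"
  assumes topspace_eq: "topspace T = carrier G"
    and manifold: "smooth_manifold T n A"
    and smooth_mult:
      "smooth_map (prod_topology T T) (n + n) (prod_atlas n A A) T n A (\<lambda>(x, y). x \<otimes> y)"
    and smooth_inv: "smooth_map T n A T n A (\<lambda>x. inv\<^bsub>G\<^esub> x)"


section \<open>Real algebraic groups and Zariski closures\<close>

definition GL :: "(real^'d^'d) monoid" where
  "GL = \<lparr>carrier = {M. invertible M}, mult = (**), one = mat 1\<rparr>"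

text \<open>The Zariski topology on \<open>X\<close> induced by \<open>\<rho>\<close> from the space of matrices. Inverting the
  determinant does not produce further closed sets of invertible matrices.\<close>

definition zariski_closed :: "('a \<Rightarrow> real^'d^'d) \<Rightarrow> 'a set \<Rightarrow> 'a set \<Rightarrow> bool" where
  "zariski_closed \<rho> X S \<longleftrightarrow>
     (\<exists>P. (\<forall>p\<in>P. real_polynomial_function p) \<and> S = {x\<in>X. \<forall>p\<in>P. p (\<rho> x) = 0})"

definition zariski_closure :: "('a \<Rightarrow> real^'d^'d) \<Rightarrow> 'a set \<Rightarrow> 'a set \<Rightarrow> 'a set" where
  "zariski_closure \<rho> X S = \<Inter>{C. zariski_closed \<rho> X C \<and> S \<subseteq> C}"

text \<open>A real algebraic structure on a Lie group: an identification \<open>\<rho>\<close>, as a Lie group, with a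
  Zariski closed subgroup of \<open>GL\<close>. (A smooth injective homomorphism has constant rank, so a smooth
  homomorphism that is a topological embedding is an isomorphism of Lie groups onto its image.)\<close>

definition real_algebraic ::
  "('a, 'b) monoid_scheme \<Rightarrow> 'a topology \<Rightarrow> nat \<Rightarrow> 'a atlas \<Rightarrow> ('a \<Rightarrow> real^'d^'d) \<Rightarrow> bool" where
  "real_algebraic G T n A \<rho> \<longleftrightarrow>
     \<rho> \<in> hom G GL \<and> embedding_map T euclidean \<rho> \<and>
     (\<forall>(U, \<phi>)\<in>A. \<forall>i j. smooth_on n (\<phi> ` U) (\<lambda>z. \<rho> (inv_into U \<phi> z) $ i $ j)) \<and>
     zariski_closed (\<lambda>M. M) (carrier GL) (\<rho> ` carrier G)"


section \<open>Markov chains on a countable set\<close>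

text \<open>A chain is given by its transition kernel \<open>K\<close>; the probability \<open>p\<^sub>e\<^sub>'\<^sub>,\<^sub>e\<close> of going from \<open>e\<close> to
  \<open>e'\<close> is \<open>pmf (K e) e'\<close>.\<close>

definition markov_step :: "('e \<Rightarrow> 'e pmf) \<Rightarrow> 'e \<Rightarrow> nat \<Rightarrow> (nat \<Rightarrow> 'e) \<Rightarrow> 'e measure" where
  "markov_step K e n \<omega> = measure_pmf (if n = 0 then return_pmf e else K (\<omega> (n - 1)))"

text \<open>The measure of Ionescu-Tulcea on \<open>E\<^sup>\<nat>\<close>; \<open>markov_measure_cylinder\<close> below is its
  characterization by cylinder sets.\<close>

definition markov_measure :: "('e::countable \<Rightarrow> 'e pmf) \<Rightarrow> 'e \<Rightarrow> (nat \<Rightarrow> 'e) measure" where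
  "markov_measure K e =
     projective_family.lim UNIV
       (Ionescu_Tulcea.CI (markov_step K e) (\<lambda>_. count_space UNIV)) (\<lambda>_. count_space UNIV)"

lemma Ionescu_Tulcea_markov:
  fixes K :: "'e::countable \<Rightarrow> 'e pmf"
  shows "Ionescu_Tulcea (markov_step K e) (\<lambda>_. count_space UNIV)"
proof (rule Ionescu_Tulcea.intro)
  show "markov_step K e i \<in> PiM {0..<i} (\<lambda>_. count_space UNIV) \<rightarrow>\<^sub>M subprob_algebra (count_space UNIV)"
    for i
  proof (cases i)
    case 0
    then show ?thesis
      by (auto simp: markov_step_def[abs_def] measure_pmf_in_subprob_algebra)
  next
    case (Suc j)
    have "(\<lambda>\<omega>. measure_pmf (K (\<omega> j)))
        \<in> PiM {0..<i} (\<lambda>_. count_space UNIV) \<rightarrow>\<^sub>M subprob_algebra (count_space UNIV)"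
      using Suc
      by (intro measurable_compose[OF measurable_component_singleton[of j]])
         (auto simp: measure_pmf_in_subprob_algebra)
    then show ?thesis
      using Suc by (simp add: markov_step_def[abs_def])
  qed
qed (simp add: markov_step_def measure_pmf.prob_space_axioms)

lemma sets_markov_measure: "sets (markov_measure K e) = sets (PiM UNIV (\<lambda>_. count_space UNIV))"
proof -
  interpret Ionescu_Tulcea "markov_step K e" "\<lambda>_. count_space UNIV"
    by (rule Ionescu_Tulcea_markov)
  show ?thesis
    unfolding markov_measure_def by (rule PF.sets_lim)
qed

lemma markov_measure_cylinder:
  "emeasure (markov_measure K e) {\<omega>. \<forall>i\<le>n. \<omega> i = x i} =
     (if x 0 = e then ennreal (\<Prod>i<n. pmf (K (x i)) (x (Suc i))) else 0)"
proof -
  let ?M = "\<lambda>_::nat. count_space (UNIV :: 'a set)"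
  interpret Ionescu_Tulcea "markov_step K e" ?M
    by (rule Ionescu_Tulcea_markov)
  define X where "X n = PiE {0..<Suc n} (\<lambda>i. {x i})" for n
  have X[measurable]: "X n \<in> sets (PiM {0..<Suc n} ?M)" for n
    unfolding X_def by (intro sets_PiM_I_finite) auto
  have u: "(\<lambda>_. undefined) \<in> space (PiM {0..<0} ?M)"
    by (simp add: space_PiM)
  have step: "eP n \<omega> (X n) = (if \<omega> = restrict x {0..<n} then
      ennreal (pmf (if n = 0 then return_pmf e else K (x (n - 1))) (x n)) else 0)"
    if "\<omega> \<in> space (PiM {0..<n} ?M)" for n \<omega>
  proof -
    have "(\<lambda>y. fun_upd \<omega> n y) -` X n \<inter> space (count_space UNIV) =
        (if \<omega> = restrict x {0..<n} then {x n} else {})"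
      using that unfolding X_def
      by (auto simp: space_PiM PiE_iff extensional_def fun_eq_iff less_Suc_eq split: if_splits)
    then show ?thesis
      using that by (subst emeasure_eP) (auto simp: markov_step_def emeasure_pmf_single)
  qed
  have C: "C 0 (Suc n) (\<lambda>_. undefined) (X n) =
     (if x 0 = e then ennreal (\<Prod>i<n. pmf (K (x i)) (x (Suc i))) else 0)" for n
  proof (induction n)
    case 0
    have "C 0 (Suc 0) (\<lambda>_. undefined) = eP 0 (\<lambda>_. undefined)"
      using bind_return[OF measurable_eP u] by simp
    then show ?case
      using step[OF u] by (auto simp: restrict_def simp del: C.simps)
  next
    case (Suc n)
    have eq: "X n = {restrict x {0..<Suc n}}"
      unfolding X_def by (auto simp: PiE_iff extensional_def fun_eq_iff)
    have "C 0 (Suc (Suc n)) (\<lambda>_. undefined) (X (Suc n)) =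
       (\<integral>\<^sup>+\<omega>. eP (Suc n) \<omega> (X (Suc n)) \<partial>C 0 (Suc n) (\<lambda>_. undefined))"
    proof -
      have ne: "space (C 0 (Suc n) (\<lambda>_. undefined)) \<noteq> {}"
        by (rule prob_space.not_empty[OF prob_space_C[OF u]])
      have meas: "eP (0 + Suc n) \<in> C 0 (Suc n) (\<lambda>_. undefined) \<rightarrow>\<^sub>M
          subprob_algebra (PiM {0..<Suc (0 + Suc n)} ?M)"
        by (subst measurable_cong_sets[OF sets_C[OF u] refl]) (rule measurable_eP)
      show ?thesis
        using emeasure_bind[OF ne meas, of "X (Suc n)"] X[of "Suc n"]
        by (simp only: C.simps(2)[of 0 "Suc n"] add_0)
    qed
    also have "\<dots> = (\<integral>\<^sup>+\<omega>. ennreal (pmf (K (x n)) (x (Suc n))) * indicator (X n) \<omega>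
        \<partial>C 0 (Suc n) (\<lambda>_. undefined))"
      by (intro nn_integral_cong) (auto simp: space_C[OF u] step eq simp del: C.simps)
    also have "\<dots> = ennreal (pmf (K (x n)) (x (Suc n))) * C 0 (Suc n) (\<lambda>_. undefined) (X n)"
      by (subst nn_integral_cmult_indicator) (auto simp: sets_C[OF u] simp del: C.simps)
    finally show ?case
      unfolding Suc by (auto simp: ennreal_mult[symmetric] prod_nonneg mult.commute)
  qed
  have "{\<omega>. \<forall>i\<le>n. \<omega> i = x i} = PF.emb UNIV {0..<Suc n} (X n)"
    by (auto simp: prod_emb_def X_def PiE_iff)
  then have "emeasure (markov_measure K e) {\<omega>. \<forall>i\<le>n. \<omega> i = x i} = CI {0..<Suc n} (X n)"
    unfolding markov_measure_def by (simp add: lim)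
  also have "\<dots> = C 0 (Suc n) (\<lambda>_. undefined) (X n)"
    by (subst emeasure_CI[of _ "Suc n"])
       (auto simp: prod_emb_id[OF sets.sets_into_space[OF X, unfolded space_PiM]] simp del: C.simps)
  finally show ?thesis
    using C by simp
qed

definition return_time :: "'e \<Rightarrow> (nat \<Rightarrow> 'e) \<Rightarrow> enat" where
  "return_time e \<omega> = Inf {enat n | n. n \<ge> 1 \<and> \<omega> n = e}"

definition irreducible_chain :: "('e::countable \<Rightarrow> 'e pmf) \<Rightarrow> bool" where
  "irreducible_chain K \<longleftrightarrow>
     (\<forall>e e'. measure (markov_measure K e) {\<omega>. return_time e' \<omega> < \<infinity>} > 0)"

definition recurrent_chain :: "('e::countable \<Rightarrow> 'e pmf) \<Rightarrow> bool" where
  "recurrent_chain K \<longleftrightarrow> (\<forall>e. measure (markov_measure K e) {\<omega>. return_time e \<omega> < \<infinity>} = 1)"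

text \<open>Words are lists in the written order: \<open>e\<^sub>n\<^sub>-\<^sub>1\<dots>e\<^sub>0\<close> is \<open>[e\<^sub>n\<^sub>-\<^sub>1, \<dots>, e\<^sub>0]\<close>, so that the
  starting state is the last element of the list.\<close>

definition admissible_between :: "('e \<Rightarrow> 'e pmf) \<Rightarrow> 'e \<Rightarrow> 'e \<Rightarrow> 'e list \<Rightarrow> bool" where
  "admissible_between K e' e w \<longleftrightarrow>
     w \<noteq> [] \<and> last w = e \<and>
     (\<forall>k. Suc k < length w \<longrightarrow> pmf (K (w ! Suc k)) (w ! k) > 0) \<and>
     pmf (K (hd w)) e' > 0"

definition admissible :: "('e \<Rightarrow> 'e pmf) \<Rightarrow> 'e list \<Rightarrow> bool" where
  "admissible K w \<longleftrightarrow> (\<exists>e e'. admissible_between K e' e w)"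

definition word_prod :: "('a, 'b) monoid_scheme \<Rightarrow> ('e \<Rightarrow> 'a) \<Rightarrow> 'e list \<Rightarrow> 'a" where
  "word_prod G g w = foldr (\<lambda>e x. g e \<otimes>\<^bsub>G\<^esub> x) w \<one>\<^bsub>G\<^esub>"


section \<open>Renewal measures and the associated semigroups and groups\<close>

text \<open>On the event that there is no return, which is null for a recurrent chain, the word is
  empty by convention.\<close>

definition return_word :: "'e \<Rightarrow> (nat \<Rightarrow> 'e) \<Rightarrow> 'e list" where
  "return_word e \<omega> =
     (case return_time e \<omega> of enat n \<Rightarrow> rev (map \<omega> [0..<n]) | \<infinity> \<Rightarrow> [])"

definition renewal_measure ::
  "('a, 'b) monoid_scheme \<Rightarrow> 'a topology \<Rightarrow> ('e::countable \<Rightarrow> 'a) \<Rightarrow> ('e \<Rightarrow> 'e pmf) \<Rightarrow> 'e \<Rightarrow> 'a measure"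
  where
  "renewal_measure G T g K e =
     distr (markov_measure K e) (sigma (topspace T) {U. openin T U})
       (\<lambda>\<omega>. word_prod G g (return_word e \<omega>))"

definition topological_support :: "'a topology \<Rightarrow> 'a measure \<Rightarrow> 'a set" where
  "topological_support T \<mu> = {x\<in>topspace T. \<forall>U. openin T U \<and> x \<in> U \<longrightarrow> emeasure \<mu> U > 0}"

definition closed_subsemigroup ::
  "('a, 'b) monoid_scheme \<Rightarrow> 'a topology \<Rightarrow> 'a set \<Rightarrow> bool" where
  "closed_subsemigroup G T S \<longleftrightarrow> closedin T S \<and> (\<forall>x\<in>S. \<forall>y\<in>S. x \<otimes>\<^bsub>G\<^esub> y \<in> S)"

definition renewal_semigroup ::
  "('a, 'b) monoid_scheme \<Rightarrow> 'a topology \<Rightarrow> ('e::countable \<Rightarrow> 'a) \<Rightarrow> ('e \<Rightarrow> 'e pmf) \<Rightarrow> 'e \<Rightarrow> 'a set"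
  where
  "renewal_semigroup G T g K e =
     \<Inter>{S. closed_subsemigroup G T S \<and> topological_support T (renewal_measure G T g K e) \<subseteq> S}"

definition admissible_products ::
  "('a, 'b) monoid_scheme \<Rightarrow> ('e \<Rightarrow> 'a) \<Rightarrow> ('e \<Rightarrow> 'e pmf) \<Rightarrow> 'a set" where
  "admissible_products G g K = {word_prod G g w | w. admissible K w}"

definition H_state ::
  "('a, 'b) monoid_scheme \<Rightarrow> 'a topology \<Rightarrow> ('a \<Rightarrow> real^'d^'d) \<Rightarrow> ('e::countable \<Rightarrow> 'a) \<Rightarrow>
    ('e \<Rightarrow> 'e pmf) \<Rightarrow> 'e \<Rightarrow> 'a set" where
  "H_state G T \<rho> g K e = zariski_closure \<rho> (carrier G) (renewal_semigroup G T g K e)"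

definition H_system ::
  "('a, 'b) monoid_scheme \<Rightarrow> ('a \<Rightarrow> real^'d^'d) \<Rightarrow> ('e \<Rightarrow> 'a) \<Rightarrow> ('e \<Rightarrow> 'e pmf) \<Rightarrow> 'a set" where
  "H_system G \<rho> g K = zariski_closure \<rho> (carrier G) (admissible_products G g K)"

end

theory Submission
  imports Defs "HOL-Library.Function_Algebras"
begin

text \<open>Let \<open>R\<^sub>e\<close> be the semigroup of all products along \<open>(e\<leftarrow>e)\<close>-admissible words. Cutting such a word
  at its visits to \<open>e\<close> writes it as a product of first-return words, which are exactly the atoms of
  the law of the return word; hence the renewal semigroup of \<open>e\<close> is the closure of \<open>R\<^sub>e\<close>, and \<open>H\<^sub>e\<close> is
  the Zariski closure of \<open>R\<^sub>e\<close>. Concatenation of words gives \<open>g\<^sub>c\<^sub>' R\<^sub>e\<^sub>' g\<^sub>c \<subseteq> R\<^sub>e\<close>, and (i) follows by continuity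
  of translations.

  The Zariski closure \<open>S\<close> of a semigroup of invertible matrices is a group. Instead of Noetherianity
  one can use that the polynomials of bounded degree vanishing on \<open>S\<close> form a finite-dimensional space
  which translation by \<open>x \<in> S\<close> maps injectively into itself, hence onto itself.

  Now (ii) follows since \<open>g\<^sub>c\<^sub>' H\<^sub>e\<^sub>' g\<^sub>c \<subseteq> H\<^sub>e\<close> contains \<open>g\<^sub>c\<^sub>' g\<^sub>c\<close>. Both (iii) and (iv) apply (ii) to one-letter
  words, together with the fact that normalizers are Zariski closed. In (v) every admissible word
  can be continued by a step to the distinguished state \<open>d\<close>, so all its products lie in \<open>H\<^sub>d\<close>.\<close>

section \<open>Polynomial functions on matrices\<close>

text \<open>Makes \<open>span\<close>, independence and the bound on the size of independent sets
  available for real functions.\<close>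

interpretation pointwise: vector_space "\<lambda>(c::real) (f::'b \<Rightarrow> real) x. c * f x"
  by unfold_locales (auto simp: fun_eq_iff algebra_simps)

text \<open>Bilinearity, one factor at a time: first \<open>u\<close> is a fixed generator, then
  \<open>f\<close> varies.\<close>

lemma span_pointwise_mult:
  fixes f h :: "'b \<Rightarrow> real"
  assumes f: "f \<in> pointwise.span B" and h: "h \<in> pointwise.span C"
  shows "(\<lambda>x. f x * h x) \<in> pointwise.span ((\<lambda>(u, v) x. u x * v x) ` (B \<times> C))"
    (is "_ \<in> pointwise.span ?D")
proof -
  have h': "(\<lambda>x. u x * h x) \<in> pointwise.span ?D" if "u \<in> B" for u
    using h
  proof (induction rule: pointwise.span_induct_alt)
    case base
    then show ?case
      using pointwise.span_zero[of ?D] by (simp add: zero_fun_def)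
  next
    case (step c v w)
    have "(\<lambda>x. u x * v x) \<in> pointwise.span ?D"
      using that step by (intro pointwise.span_base) force
    from pointwise.span_add[OF pointwise.span_scale[OF this, of c] step(2)]
    show ?case
      by (simp add: plus_fun_def algebra_simps)
  qed
  show ?thesis
    using f
  proof (induction rule: pointwise.span_induct_alt)
    case base
    then show ?case
      using pointwise.span_zero[of ?D] by (simp add: zero_fun_def)
  next
    case (step c u w)
    from pointwise.span_add[OF pointwise.span_scale[OF h'[OF step(1)], of c] step(2)]
    show ?case
      by (simp add: plus_fun_def algebra_simps)
  qed
qed

lemma sum_fun_apply: "(\<Sum>i\<in>I. f i) x = (\<Sum>i\<in>I. (f i x :: real))"
  by (induction I rule: infinite_finite_induct) auto

text \<open>The set \<open>B\<close> depends on \<open>p\<close> alone: its span plays the part of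
  the polynomials of bounded degree, a space that linear substitutions preserve.\<close>

lemma polynomial_translates_finite_span:
  fixes p :: "'b::euclidean_space \<Rightarrow> real"
  assumes "real_polynomial_function p"
  shows "\<exists>B. finite B \<and> (\<forall>L :: 'b \<Rightarrow> 'b. linear L \<longrightarrow> (\<lambda>y. p (L y)) \<in> pointwise.span B)"
  using assms
proof (induction rule: real_polynomial_function.induct)
  case (linear f)
  let ?B = "(\<lambda>b y. y \<bullet> b) ` (Basis :: 'b set)"
  have "(\<lambda>y. f (L y)) \<in> pointwise.span ?B" if "linear L" for L :: "'b \<Rightarrow> 'b"
  proof -
    have lin: "linear (\<lambda>y. f (L y))"
      using linear_compose[OF that bounded_linear.linear[OF linear]] by (simp add: o_def)
    have eq: "f (L y) = (\<Sum>b\<in>Basis. f (L b) * (y \<bullet> b))" for y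
    proof -
      have "f (L y) = f (L (\<Sum>b\<in>Basis. (y \<bullet> b) *\<^sub>R b))"
        by (simp add: euclidean_representation)
      also have "\<dots> = (\<Sum>b\<in>Basis. f (L b) * (y \<bullet> b))"
        using linear_sum[OF lin, of "\<lambda>b. (y \<bullet> b) *\<^sub>R b" Basis] linear_scale[OF lin]
        by (simp add: mult.commute)
      finally show ?thesis .
    qed
    have "(\<lambda>y. f (L y)) = (\<Sum>b\<in>Basis. (\<lambda>y. f (L b) * (y \<bullet> b)))"
      unfolding fun_eq_iff sum_fun_apply by (intro allI eq)
    also have "\<dots> \<in> pointwise.span ?B"
    proof (rule pointwise.span_sum)
      fix b :: 'b assume "b \<in> Basis"
      then have "(\<lambda>y. y \<bullet> b) \<in> pointwise.span ?B"
        by (intro pointwise.span_base) auto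
      from pointwise.span_scale[OF this, of "f (L b)"]
      show "(\<lambda>y. f (L b) * (y \<bullet> b)) \<in> pointwise.span ?B" .
    qed
    finally show ?thesis .
  qed
  then show ?case
    by (intro exI[of _ ?B]) auto
next
  case (const c)
  show ?case
    using pointwise.span_scale[OF pointwise.span_base[of "\<lambda>_. 1" "{\<lambda>_. 1}"], of c]
    by (intro exI[of _ "{\<lambda>_. 1}"]) auto
next
  case (add f h)
  then obtain B C where "finite B" "finite C"
    and B: "\<And>L :: 'b \<Rightarrow> 'b. linear L \<Longrightarrow> (\<lambda>y. f (L y)) \<in> pointwise.span B"
    and C: "\<And>L :: 'b \<Rightarrow> 'b. linear L \<Longrightarrow> (\<lambda>y. h (L y)) \<in> pointwise.span C"
    by blast
  have "(\<lambda>y. f (L y) + h (L y)) \<in> pointwise.span (B \<union> C)" if "linear L" for L :: "'b \<Rightarrow> 'b"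
    using pointwise.span_add[of "\<lambda>y. f (L y)" "B \<union> C" "\<lambda>y. h (L y)"] B[OF that] C[OF that]
      pointwise.span_mono[of B "B \<union> C"] pointwise.span_mono[of C "B \<union> C"]
    by (auto simp: plus_fun_def)
  with \<open>finite B\<close> \<open>finite C\<close> show ?case
    by (intro exI[of _ "B \<union> C"]) auto
next
  case (mult f h)
  then obtain B C where "finite B" "finite C"
    and "\<And>L :: 'b \<Rightarrow> 'b. linear L \<Longrightarrow> (\<lambda>y. f (L y)) \<in> pointwise.span B"
    and "\<And>L :: 'b \<Rightarrow> 'b. linear L \<Longrightarrow> (\<lambda>y. h (L y)) \<in> pointwise.span C"
    by blast
  then show ?case
    by (intro exI[of _ "(\<lambda>(u, v) x. u x * v x) ` (B \<times> C)"]) (auto intro!: span_pointwise_mult)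
qed

text \<open>The functions \<open>p \<circ> L\<^sup>j\<close> lie in a finite-dimensional space, so for some \<open>j\<close> the function
  \<open>p \<circ> L\<^sup>j\<close> is a combination of the later ones; evaluate this relation at \<open>L'\<^sup>j\<^sup>+\<^sup>1 y\<close>.\<close>

lemma polynomial_vanishes_on_backward_orbit:
  fixes p :: "'b::euclidean_space \<Rightarrow> real" and L :: "'b \<Rightarrow> 'b"
  assumes p: "real_polynomial_function p" and L: "linear L" and LL': "\<And>z. L (L' z) = z"
    and zero: "\<And>k. p ((L ^^ k) y) = 0"
  shows "p (L' y) = 0"
proof -
  obtain B where B: "finite B" "\<And>M :: 'b \<Rightarrow> 'b. linear M \<Longrightarrow> (\<lambda>y. p (M y)) \<in> pointwise.span B"
    using polynomial_translates_finite_span[OF p] by blast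
  define f where "f j = (\<lambda>z. p ((L ^^ j) z))" for j
  have linpow: "linear (L ^^ j)" for j
  proof (induction j)
    case (Suc j)
    then show ?case using linear_compose[OF Suc L] by (simp add: o_def)
  qed (simp add: linear_id[unfolded id_def] id_def)
  have "\<exists>j. f j \<in> pointwise.span (f ` {j<..})"
  proof (rule ccontr)
    assume "\<nexists>j. f j \<in> pointwise.span (f ` {j<..})"
    then have nin: "f j \<notin> pointwise.span (f ` {j<..})" for j
      by blast
    \<comment> \<open>The block grows at its lower end: \<open>f (N - Suc k)\<close> lies outside
      the span of all later functions. With \<open>k = N = Suc (card B)\<close> the block is too
      large for the span of \<open>B\<close>.\<close>
    have "pointwise.independent (f ` {N - k..<N}) \<and> card (f ` {N - k..<N}) = k" if "k \<le> N" for N k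
      using that
    proof (induction k)
      case 0
      then show ?case by (simp add: pointwise.independent_empty)
    next
      case (Suc k)
      let ?S = "f ` {N - k..<N}"
      have eq: "{N - Suc k..<N} = insert (N - Suc k) {N - k..<N}"
        using Suc.prems by auto
      have "?S \<subseteq> f ` {N - Suc k<..}"
        using Suc.prems by (intro image_mono) auto
      then have n: "f (N - Suc k) \<notin> pointwise.span ?S"
        using nin[of "N - Suc k"] pointwise.span_mono[of ?S "f ` {N - Suc k<..}"] by blast
      then have "f (N - Suc k) \<notin> ?S"
        using pointwise.span_superset[of ?S] by blast
      moreover have "pointwise.independent ?S" "card ?S = k"
        using Suc by simp_all
      ultimately show ?case
        unfolding eq image_insert using pointwise.independent_insertI[OF n] by simp
    qed
    from this[of "Suc (card B)" "Suc (card B)"]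
    have "pointwise.independent (f ` {0..<Suc (card B)})" "card (f ` {0..<Suc (card B)}) = Suc (card B)"
      by simp_all
    moreover have "f ` {0..<Suc (card B)} \<subseteq> pointwise.span B"
      using B(2)[OF linpow] by (auto simp: f_def)
    ultimately show False
      using pointwise.independent_span_bound[OF B(1)] by fastforce
  qed
  then obtain j where j: "f j \<in> pointwise.span (f ` {j<..})" by blast
  define z where "z = (L' ^^ Suc j) y"
  have cancel: "(L ^^ i) ((L' ^^ i) w) = w" for i w
  proof (induction i arbitrary: w)
    case (Suc i)
    have "(L ^^ Suc i) ((L' ^^ Suc i) w) = (L ^^ i) (L (L' ((L' ^^ i) w)))"
      by (simp add: funpow_swap1)
    then show ?case using Suc LL' by simp
  qed simp
  \<comment> \<open>For \<open>i > j\<close> the power \<open>L ^^ i\<close> cancels every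
    \<open>L'\<close> in \<open>z\<close> and lands on the forward orbit of \<open>y\<close>,
    whereas \<open>L ^^ j\<close> leaves exactly one \<open>L'\<close>.\<close>
  have later: "f i z = 0" if "i > j" for i
  proof -
    have "(L ^^ i) z = (L ^^ (i - Suc j)) ((L ^^ Suc j) z)"
      using that by (metis Suc_leI funpow_add le_add_diff_inverse2 comp_apply)
    then show ?thesis
      using zero by (simp add: f_def z_def cancel del: funpow.simps)
  qed
  have "u z = 0" if "u \<in> pointwise.span (f ` {j<..})" for u
    using that by (induction rule: pointwise.span_induct_alt) (auto simp: later)
  then have "f j z = 0"
    using j by blast
  moreover have "(L ^^ j) z = L' y"
    by (simp add: z_def funpow_swap1 cancel)
  ultimately show ?thesis
    by (simp add: f_def)
qed

text \<open>Homogenization by induction on \<open>p\<close>; \<open>k\<close> is some sufficiently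
  large power, not the least one.\<close>

lemma polynomial_clear_denominator:
  fixes F :: "'b::real_normed_vector \<Rightarrow> 'c::euclidean_space"
  assumes p: "real_polynomial_function p" and F: "polynomial_function F"
    and D: "real_polynomial_function D"
  shows "\<exists>k q. real_polynomial_function q \<and>
    (\<forall>x. D x \<noteq> 0 \<longrightarrow> q x = D x ^ k * p (F x /\<^sub>R D x))"
  using p
proof (induction rule: real_polynomial_function.induct)
  case (linear f)
  have "real_polynomial_function (\<lambda>x. f (F x))"
    using real_polynomial_function_compose[OF F real_polynomial_function.intros(1)[OF linear]]
    by (simp add: o_def)
  moreover have "f (F x) = D x ^ 1 * f (F x /\<^sub>R D x)" if "D x \<noteq> 0" for x
    using that by (simp add: linear_cmul[OF bounded_linear.linear[OF linear]])
  ultimately show ?case by blast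
next
  case (const c)
  show ?case
    by (intro exI[of _ 0] exI[of _ "\<lambda>_. c"]) auto
next
  case (add f h)
  then obtain k q l r where "real_polynomial_function q" "real_polynomial_function r"
    and "\<And>x. D x \<noteq> 0 \<Longrightarrow> q x = D x ^ k * f (F x /\<^sub>R D x)"
    and "\<And>x. D x \<noteq> 0 \<Longrightarrow> r x = D x ^ l * h (F x /\<^sub>R D x)"
    by blast
  \<comment> \<open>Cross-multiplication: each summand receives the power of \<open>D\<close> that
    belongs to the other.\<close>
  with D show ?case
    by (intro exI[of _ "k + l"] exI[of _ "\<lambda>x. D x ^ l * q x + D x ^ k * r x"])
       (auto simp: power_add ring_distribs mult_ac intro!: real_polynomial_function.intros(3,4))
next
  case (mult f h)
  then obtain k q l r where "real_polynomial_function q" "real_polynomial_function r"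
    and "\<And>x. D x \<noteq> 0 \<Longrightarrow> q x = D x ^ k * f (F x /\<^sub>R D x)"
    and "\<And>x. D x \<noteq> 0 \<Longrightarrow> r x = D x ^ l * h (F x /\<^sub>R D x)"
    by blast
  then show ?case
    by (intro exI[of _ "k + l"] exI[of _ "\<lambda>x. q x * r x"]) (auto simp: power_add)
qed

section \<open>Determinants and matrix inversion\<close>

lemma polynomial_function_matrix_iff:
  fixes F :: "'b::real_normed_vector \<Rightarrow> real^'n^'m"
  shows "polynomial_function F \<longleftrightarrow> (\<forall>i j. real_polynomial_function (\<lambda>x. F x $ i $ j))"
  by (auto simp: polynomial_function_iff_Basis_inner Basis_vec_def inner_axis)

lemma real_polynomial_function_matrix_entry:
  "real_polynomial_function (\<lambda>M :: real^'n^'m. M $ i $ j)"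
  using polynomial_function_matrix_iff[of "\<lambda>M. M"] by blast

lemma real_polynomial_function_det:
  fixes F :: "'b::real_normed_vector \<Rightarrow> real^'n^'n"
  assumes "polynomial_function F"
  shows "real_polynomial_function (\<lambda>x. det (F x))"
  using assms unfolding det_def
  by (intro real_polynomial_function_sum real_polynomial_function_prod
      real_polynomial_function.intros(2,4))
     (auto simp: polynomial_function_matrix_iff finite_permutations)

lemma polynomial_function_matrix_mult:
  fixes F :: "'b::real_normed_vector \<Rightarrow> real^'n^'m" and F' :: "'b \<Rightarrow> real^'k^'n"
  assumes "polynomial_function F" "polynomial_function F'"
  shows "polynomial_function (\<lambda>x. F x ** F' x)"
  using assms unfolding polynomial_function_matrix_iff matrix_matrix_mult_def
  by (auto intro!: real_polynomial_function_sum real_polynomial_function.intros(4))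

text \<open>Each cofactor is written as a Cramer numerator, with column \<open>k\<close> replaced by
  a unit vector, so that \<open>cramer\<close> applies column by column.\<close>

definition adjugate :: "real^'n^'n \<Rightarrow> real^'n^'n" where
  "adjugate M = (\<chi> k l. det (\<chi> i j. if j = k then axis l 1 $ i else M $ i $ j))"

lemma polynomial_function_adjugate: "polynomial_function adjugate"
  unfolding polynomial_function_matrix_iff adjugate_def
proof (intro allI, unfold vec_lambda_beta, rule real_polynomial_function_det,
    unfold polynomial_function_matrix_iff, intro allI)
  show "real_polynomial_function (\<lambda>M :: real^'a^'a.
      (\<chi> i j. if j = k then axis l 1 $ i else M $ i $ j) $ i $ j)" for k l i j
    by (cases "j = k") (auto simp: real_polynomial_function_matrix_entry)
qed

lemma matrix_mult_adjugate:
  fixes M :: "real^'n^'n"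
  assumes "det M \<noteq> 0"
  shows "M ** (adjugate M /\<^sub>R det M) = mat 1"
proof -
  have "column l (M ** (adjugate M /\<^sub>R det M)) = axis l 1" for l
  proof -
    have "column l (adjugate M /\<^sub>R det M) =
        (\<chi> k. det (\<chi> i j. if j = k then axis l 1 $ i else M $ i $ j) / det M)"
      by (simp add: column_def adjugate_def vec_eq_iff field_simps)
    then have "M *v column l (adjugate M /\<^sub>R det M) = axis l 1"
      using cramer[OF assms] by blast
    then show ?thesis
      by (simp add: column_def matrix_matrix_mult_def matrix_vector_mult_def vec_eq_iff)
  qed
  then show ?thesis
    by (auto simp: column_def vec_eq_iff mat_def axis_def)
qed

text \<open>Conjugation by a variable matrix is rational, namely \<open>M ** B ** adjugate M\<close>
  over \<open>det M\<close>, and a power of the determinant clears the denominator. Stating the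
  inverse as \<open>M ** N = mat 1\<close> lets \<open>N\<close> be the image of a group
  inverse.\<close>

lemma conjugation_clear_denominator:
  fixes p :: "real^'n^'n \<Rightarrow> real" and B :: "real^'n^'n"
  assumes "real_polynomial_function p"
  shows "\<exists>k q. real_polynomial_function q \<and>
    (\<forall>M N. M ** N = mat 1 \<longrightarrow> q M = det M ^ k * p (M ** B ** N))"
proof -
  have F: "polynomial_function (\<lambda>M. M ** B ** adjugate M)"
    by (intro polynomial_function_matrix_mult polynomial_function_adjugate) auto
  obtain k q where q: "real_polynomial_function q"
    "\<And>M. det M \<noteq> 0 \<Longrightarrow> q M = det M ^ k * p ((M ** B ** adjugate M) /\<^sub>R det M)"
    using polynomial_clear_denominator[OF assms F real_polynomial_function_det[OF polynomial_function_id]]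
    by blast
  have "q M = det M ^ k * p (M ** B ** N)" if MN: "M ** N = mat 1" for M N
  proof -
    have d: "det M \<noteq> 0"
      using MN by (metis det_I det_mul mult_zero_left zero_neq_one)
    have "adjugate M /\<^sub>R det M = N"
      using matrix_mult_adjugate[OF d] MN matrix_left_right_inverse
      by (metis matrix_mul_assoc matrix_mul_lid)
    moreover have "(C ** D) /\<^sub>R c = C ** (D /\<^sub>R c)" for C D :: "real^'n^'n" and c
      by (simp add: vec_eq_iff matrix_matrix_mult_def sum_distrib_left mult.left_commute)
    ultimately have "(M ** B ** adjugate M) /\<^sub>R det M = M ** B ** N"
      by simp
    then show ?thesis using q(2)[OF d] by simp
  qed
  with q(1) show ?thesis by blast
qed

section \<open>Return words of a Markov chain\<close>

lemma admissible_between_Cons: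
  "admissible_between K a b (x # w) \<longleftrightarrow>
     pmf (K x) a > 0 \<and> (if w = [] then x = b else admissible_between K x b w)"
proof (cases w)
  case Nil
  then show ?thesis by (auto simp: admissible_between_def)
next
  case (Cons y v)
  have "(\<forall>k. Suc k < length (x # w) \<longrightarrow> pmf (K ((x # w) ! Suc k)) ((x # w) ! k) > 0) \<longleftrightarrow>
      pmf (K y) x > 0 \<and> (\<forall>k. Suc k < length w \<longrightarrow> pmf (K (w ! Suc k)) (w ! k) > 0)"
    (is "(\<forall>k. ?P k) \<longleftrightarrow> _")
  proof -
    have "(\<forall>k. ?P k) \<longleftrightarrow> ?P 0 \<and> (\<forall>k. ?P (Suc k))"
      by (metis not0_implies_Suc)
    then show ?thesis using Cons by auto
  qed
  then show ?thesis
    using Cons by (auto simp: admissible_between_def)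
qed

text \<open>Words run right to left, so \<open>v\<close> is traversed first and its closing
  transition leads to \<open>last u\<close>, the state where \<open>u\<close> starts.\<close>

lemma admissible_between_append:
  assumes "u \<noteq> []" "v \<noteq> []"
  shows "admissible_between K a b (u @ v) \<longleftrightarrow>
     admissible_between K a (last u) u \<and> admissible_between K (last u) b v"
  using assms(1)
proof (induction u arbitrary: a)
  case (Cons x u)
  then show ?case using assms(2)
    by (cases "u = []") (auto simp: admissible_between_Cons)
qed simp

lemma admissible_between_trans:
  assumes "admissible_between K a b u" "admissible_between K b c v"
  shows "admissible_between K a c (u @ v)"
proof -
  have "u \<noteq> []" "v \<noteq> []" "last u = b"
    using assms by (auto simp: admissible_between_def)
  with assms show ?thesis
    by (subst admissible_between_append) auto
qed

text \<open>Translates trajectories into words: the letters are the states at times \<open>0\<close>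
  to \<open>n - 1\<close>, while \<open>x n\<close> is only the target of the last
  transition.\<close>

lemma admissible_between_path:
  assumes "n > 0"
  shows "admissible_between K (x n) (x 0) (rev (map x [0..<n])) \<longleftrightarrow>
     (\<forall>i<n. pmf (K (x i)) (x (Suc i)) > 0)"
  using assms
proof (induction n rule: nat_induct_non_zero)
  case 1
  then show ?case by (simp add: admissible_between_Cons)
next
  case (Suc n)
  then show ?case by (auto simp: admissible_between_Cons less_Suc_eq)
qed

section \<open>Almost sure behaviour of trajectories\<close>

lemma space_markov_measure [simp]: "space (markov_measure K e) = UNIV"
  using sets_eq_imp_space_eq[OF sets_markov_measure[of K e]] by (simp add: space_PiM)

lemma prob_space_markov_measure: "prob_space (markov_measure K e)"
proof (rule prob_spaceI)
  let ?M = "\<lambda>_::nat. count_space (UNIV :: 'a set)"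
  interpret Ionescu_Tulcea "markov_step K e" ?M
    by (rule Ionescu_Tulcea_markov)
  interpret P0: prob_space "CI {0}"
    by (rule PF.prob_space_P) auto
  \<comment> \<open>The whole space is the cylinder with full base over coordinate \<open>0\<close>,
    so its mass is that of a marginal.\<close>
  have "UNIV = PF.emb UNIV {0} (space (PiM {0} ?M))"
    by (auto simp: prod_emb_def space_PiM)
  then have "emeasure (markov_measure K e) UNIV = CI {0} (space (PiM {0} ?M))"
    unfolding markov_measure_def by (metis lim finite.emptyI finite.insertI sets.top)
  also have "\<dots> = 1"
    using P0.emeasure_space_1 PF.space_P[of "{0}"] by simp
  finally show "emeasure (markov_measure K e) (space (markov_measure K e)) = 1"
    by simp
qed

lemma cylinder_sets: "{\<omega>. \<forall>i\<le>n. \<omega> i = x i} \<in> sets (markov_measure K e)"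
proof -
  have "{\<omega>\<in>space (PiM UNIV (\<lambda>_::nat. count_space (UNIV :: 'a::countable set))). \<forall>i\<le>n. \<omega> i = x i}
      \<in> sets (PiM UNIV (\<lambda>_. count_space UNIV))"
    by measurable
  then show ?thesis
    by (simp add: sets_markov_measure space_PiM)
qed

text \<open>There are countably many cylinders, so those of mass zero can be avoided simultaneously.
  For any other path all cylinders around it have positive mass, and the product formula excludes
  impossible steps.\<close>

lemma AE_markov_path:
  fixes K :: "'e::countable \<Rightarrow> 'e pmf"
  shows "AE \<omega> in markov_measure K e. \<omega> 0 = e \<and> (\<forall>n. pmf (K (\<omega> n)) (\<omega> (Suc n)) > 0)"
proof -
  \<comment> \<open>Lists index the cylinders to make them countable. For the empty list the bound
    is \<open>0\<close> and \<open>xs ! 0\<close> is unspecified, which is harmless because all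
    cylinders are treated alike.\<close>
  let ?C = "\<lambda>xs :: 'e list. {\<omega>. \<forall>i\<le>length xs - 1. \<omega> i = xs ! i}"
  have "AE \<omega> in markov_measure K e. \<forall>xs. emeasure (markov_measure K e) (?C xs) = 0 \<longrightarrow> \<omega> \<notin> ?C xs"
  proof (subst AE_all_countable, intro allI)
    fix xs :: "'e list"
    show "AE \<omega> in markov_measure K e. emeasure (markov_measure K e) (?C xs) = 0 \<longrightarrow> \<omega> \<notin> ?C xs"
    proof (cases "emeasure (markov_measure K e) (?C xs) = 0")
      case True
      then have "?C xs \<in> null_sets (markov_measure K e)"
        using cylinder_sets by blast
      then show ?thesis by (rule AE_I'[of "?C xs"]) auto
    qed simp
  qed
  then show ?thesis
  proof (rule AE_mp, intro AE_I2 impI)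
    fix \<omega> :: "nat \<Rightarrow> 'e"
    assume *: "\<forall>xs. emeasure (markov_measure K e) (?C xs) = 0 \<longrightarrow> \<omega> \<notin> ?C xs"
    have "emeasure (markov_measure K e) {\<omega>'. \<forall>i\<le>n. \<omega>' i = \<omega> i} \<noteq> 0" for n
    proof -
      have "?C (map \<omega> [0..<Suc n]) = {\<omega>'. \<forall>i\<le>n. \<omega>' i = \<omega> i}"
        by (auto simp del: upt_Suc)
      then show ?thesis
        using *[rule_format, of "map \<omega> [0..<Suc n]"] by auto
    qed
    then have pos: "\<omega> 0 = e \<and> (\<Prod>i<n. pmf (K (\<omega> i)) (\<omega> (Suc i))) \<noteq> 0" for n
      unfolding markov_measure_cylinder by (metis ennreal_0)
    have "pmf (K (\<omega> n)) (\<omega> (Suc n)) \<noteq> 0" for n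
      using pos[of "Suc n"] by (auto simp: prod_zero_iff)
    then show "\<omega> 0 = e \<and> (\<forall>n. pmf (K (\<omega> n)) (\<omega> (Suc n)) > 0)"
      using pos by (auto simp: order_less_le)
  qed
qed

lemma AE_imp_ex_in_positive_set:
  assumes "AE x in M. P x" "A \<in> sets M" "emeasure M A > 0"
  shows "\<exists>x\<in>A. P x"
proof (rule ccontr)
  assume "\<not> (\<exists>x\<in>A. P x)"
  with assms(1) have "AE x in M. x \<notin> A"
    by (auto elim: AE_mp)
  then have "emeasure M A = 0"
    using assms(2) by (simp add: AE_iff_measurable[OF _ refl] emeasure_0_AE AE_iff_null_sets null_setsD1)
  with assms(3) show False by simp
qed

section \<open>First return times and measurability of return words\<close>

lemma return_time_eqI:
  assumes "n > 0" "\<omega> n = e" "\<And>k. 0 < k \<Longrightarrow> k < n \<Longrightarrow> \<omega> k \<noteq> e"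
  shows "return_time e \<omega> = enat n"
  unfolding return_time_def
proof (rule Inf_eqI)
  fix t assume "t \<in> {enat n | n. n \<ge> 1 \<and> \<omega> n = e}"
  then obtain m where "t = enat m" "m \<ge> 1" "\<omega> m = e" by blast
  with assms(3)[of m] show "enat n \<le> t"
    by (cases "m < n") auto
next
  fix t assume "\<And>i. i \<in> {enat n | n. n \<ge> 1 \<and> \<omega> n = e} \<Longrightarrow> t \<le> i"
  then show "t \<le> enat n"
    using assms(1,2) by (auto simp: Suc_le_eq)
qed

text \<open>In \<open>enat\<close> the infimum of the empty set is infinite, so a finite value is
  the least element of a nonempty set.\<close>

lemma return_time_finiteE:
  assumes "return_time e \<omega> < \<infinity>"
  obtains n where "n > 0" "return_time e \<omega> = enat n" "\<omega> n = e"
    "\<And>k. 0 < k \<Longrightarrow> k < n \<Longrightarrow> \<omega> k \<noteq> e"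
proof -
  let ?Q = "\<lambda>n. n > 0 \<and> \<omega> n = e"
  have "\<exists>n. ?Q n"
  proof (rule ccontr)
    assume "\<nexists>n. ?Q n"
    then have "{enat n | n. n \<ge> 1 \<and> \<omega> n = e} = {}" by (simp add: Suc_le_eq)
    then have "return_time e \<omega> = \<infinity>"
      unfolding return_time_def by (simp only: Inf_empty top_enat_def)
    with assms show False by simp
  qed
  then have L: "?Q (Least ?Q)"
    by (rule LeastI_ex)
  moreover have "\<omega> k \<noteq> e" if "0 < k" "k < Least ?Q" for k
    using not_less_Least[OF that(2)] that(1) by simp
  ultimately show thesis
    using that return_time_eqI[of "Least ?Q" \<omega> e] by blast
qed

lemma return_time_eq_iff:
  "return_time e \<omega> = enat n \<longleftrightarrow> n > 0 \<and> \<omega> n = e \<and> (\<forall>k. 0 < k \<and> k < n \<longrightarrow> \<omega> k \<noteq> e)"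
proof
  assume *: "return_time e \<omega> = enat n"
  then have "return_time e \<omega> < \<infinity>" by simp
  from return_time_finiteE[OF this] *
  show "n > 0 \<and> \<omega> n = e \<and> (\<forall>k. 0 < k \<and> k < n \<longrightarrow> \<omega> k \<noteq> e)"
    by (metis enat.inject)
qed (auto intro: return_time_eqI)

text \<open>Such an event is a union of cylinders indexed by lists, a countable family.\<close>

lemma finitely_determined_sets:
  fixes K :: "'e::countable \<Rightarrow> 'e pmf"
  assumes "\<And>\<omega> \<omega>'. \<forall>i\<le>n. \<omega>' i = \<omega> i \<Longrightarrow> \<omega> \<in> A \<Longrightarrow> \<omega>' \<in> A"
  shows "A \<in> sets (markov_measure K e)"
proof -
  let ?C = "\<lambda>xs :: 'e list. {\<omega>. \<forall>i\<le>n. \<omega> i = xs ! i}"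
  let ?X = "(\<lambda>\<omega>. map \<omega> [0..<Suc n]) ` A"
  have "A = (\<Union>xs\<in>?X. ?C xs)"
  proof (intro subset_antisym subsetI)
    fix \<omega> assume "\<omega> \<in> A"
    then show "\<omega> \<in> (\<Union>xs\<in>?X. ?C xs)"
      by (intro UN_I[of "map \<omega> [0..<Suc n]"]) (auto simp del: upt_Suc)
  next
    fix \<omega> assume "\<omega> \<in> (\<Union>xs\<in>?X. ?C xs)"
    then obtain \<omega>' where "\<omega>' \<in> A" "\<forall>i\<le>n. \<omega> i = map \<omega>' [0..<Suc n] ! i"
      by blast
    then show "\<omega> \<in> A"
      by (intro assms[of \<omega> \<omega>']) (auto simp del: upt_Suc)
  qed
  moreover have "(\<Union>xs\<in>?X. ?C xs) \<in> sets (markov_measure K e)"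
    by (intro sets.countable_UN'' cylinder_sets) auto
  ultimately show ?thesis by simp
qed

lemma return_word_eq_iff:
  assumes "w \<noteq> []"
  shows "return_word e \<omega> = w \<longleftrightarrow>
    return_time e \<omega> = enat (length w) \<and> rev (map \<omega> [0..<length w]) = w"
  using assms by (auto simp: return_word_def split: enat.splits)

lemma return_word_measurable:
  fixes K :: "'e::countable \<Rightarrow> 'e pmf"
  shows "return_word e \<in> markov_measure K f \<rightarrow>\<^sub>M count_space UNIV"
proof -
  \<comment> \<open>The coordinate \<open>length w\<close> has to be included, since it records the
    return itself.\<close>
  have *: "{\<omega>. return_word e \<omega> = w} \<in> sets (markov_measure K f)" if "w \<noteq> []" for w
  proof (rule finitely_determined_sets[of "length w"])
    fix \<omega> \<omega>' :: "nat \<Rightarrow> 'e"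
    assume eq: "\<forall>i\<le>length w. \<omega>' i = \<omega> i" and "\<omega> \<in> {\<omega>. return_word e \<omega> = w}"
    moreover have "map \<omega>' [0..<length w] = map \<omega> [0..<length w]"
      using eq by auto
    ultimately show "\<omega>' \<in> {\<omega>. return_word e \<omega> = w}"
      using that by (simp add: return_word_eq_iff return_time_eq_iff del: map_eq_conv)
  qed
  have "return_word e -` {w} \<in> sets (markov_measure K f)" for w
  proof (cases "w = []")
    case True
    \<comment> \<open>The empty word stands for the absence of a return; this event is reached as
      the complement of countably many others.\<close>
    have "return_word e -` {w} =
        space (markov_measure K f) - (\<Union>v\<in>- {[]}. {\<omega>. return_word e \<omega> = v})"
      using True by auto
    also have "\<dots> \<in> sets (markov_measure K f)"
      by (intro sets.Diff sets.top sets.countable_UN'' *) auto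
    finally show ?thesis .
  next
    case False
    then show ?thesis using *[of w] by (simp add: vimage_def)
  qed
  then show ?thesis
    by (subst measurable_count_space_eq2_countable) auto
qed

text \<open>The event of reaching \<open>a\<close> has positive probability, so it contains a path
  all of whose steps are possible; the word is read off up to the first arrival.\<close>

lemma admissible_between_exists:
  assumes "irreducible_chain K"
  shows "\<exists>w. admissible_between K a b w"
proof -
  let ?M = "markov_measure K b" and ?A = "{\<omega>. return_time a \<omega> < \<infinity>}"
  have pos: "measure ?M ?A > 0"
    using assms by (simp add: irreducible_chain_def)
  \<comment> \<open>A non-measurable set has \<open>measure\<close> zero, so positivity already
    yields measurability.\<close>
  then have A: "?A \<in> sets ?M"
    using measure_notin_sets by fastforce
  have "emeasure ?M ?A > 0"
    using pos by (metis not_gr_zero measure_def enn2real_0 less_irrefl)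
  from AE_imp_ex_in_positive_set[OF AE_markov_path A this]
  obtain \<omega> where \<omega>: "return_time a \<omega> < \<infinity>" "\<omega> 0 = b" "\<And>n. pmf (K (\<omega> n)) (\<omega> (Suc n)) > 0"
    by blast
  obtain n where "n > 0" "\<omega> n = a"
    using return_time_finiteE[OF \<omega>(1)] by blast
  then have "admissible_between K a b (rev (map \<omega> [0..<n]))"
    using admissible_between_path[of n K \<omega>] \<omega>(2,3) by simp
  then show ?thesis by blast
qed

lemma AE_return_word_admissible:
  assumes "recurrent_chain K"
  shows "AE \<omega> in markov_measure K e. admissible_between K e e (return_word e \<omega>)"
proof -
  interpret prob_space "markov_measure K e"
    by (rule prob_space_markov_measure)
  have "AE \<omega> in markov_measure K e. return_time e \<omega> < \<infinity>"
    using assms AE_prob_1[of "{\<omega>. return_time e \<omega> < \<infinity>}"] by (simp add: recurrent_chain_def)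
  with AE_markov_path show ?thesis
  proof eventually_elim
    case (elim \<omega>)
    obtain n where "n > 0" "return_time e \<omega> = enat n" "\<omega> n = e"
      using return_time_finiteE[OF elim(2)] by blast
    then show ?case
      using admissible_between_path[of n K \<omega>] elim(1) by (simp add: return_word_def)
  qed
qed

text \<open>The assumption \<open>first\<close> says that \<open>w\<close> has no intermediate visit
  to \<open>e\<close>; then a whole cylinder of positive mass returns along
  \<open>w\<close>.\<close>

lemma first_return_word_positive:
  assumes w: "admissible_between K e e w"
    and first: "\<And>u v. w = u @ v \<Longrightarrow> u \<noteq> [] \<Longrightarrow> v \<noteq> [] \<Longrightarrow> last u \<noteq> e"
  shows "emeasure (markov_measure K e) {\<omega>. return_word e \<omega> = w} > 0"
proof -
  define n where "n = length w"
  \<comment> \<open>\<open>rev w\<close> turns the written order into the order of time; the value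
    \<open>e\<close> at index \<open>n\<close> is the return.\<close>
  define x where "x i = (if i < n then rev w ! i else e)" for i
  have ne: "w \<noteq> []" and last: "last w = e"
    using w by (auto simp: admissible_between_def)
  then have n: "n > 0" and x0: "x 0 = e" and xn: "x n = e"
    by (auto simp: n_def x_def rev_nth last_conv_nth)
  have "map x [0..<n] = rev w"
    by (rule nth_equalityI) (auto simp: n_def x_def)
  then have word: "rev (map x [0..<n]) = w" by simp
  \<comment> \<open>Time \<open>k\<close> is position \<open>n - Suc k\<close> of \<open>w\<close>,
    so a visit to \<open>e\<close> at that time would be a forbidden cut.\<close>
  have xk: "x k \<noteq> e" if "0 < k" "k < n" for k
  proof -
    let ?u = "take (n - k) w" and ?v = "drop (n - k) w"
    have "last ?u = w ! (n - Suc k)"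
      using that by (subst last_conv_nth) (auto simp: n_def)
    moreover have "x k = w ! (n - Suc k)"
      using that by (simp add: x_def n_def rev_nth)
    moreover have "last ?u \<noteq> e"
      using that by (intro first[of ?u ?v]) (auto simp: n_def)
    ultimately show ?thesis by simp
  qed
  have pos: "pmf (K (x i)) (x (Suc i)) > 0" if "i < n" for i
    using admissible_between_path[OF n, of K x] w that unfolding word x0 xn by simp
  have "0 < emeasure (markov_measure K e) {\<omega>. \<forall>i\<le>n. \<omega> i = x i}"
    using pos by (auto simp: markov_measure_cylinder x0 intro!: prod_pos)
  also have "\<dots> \<le> emeasure (markov_measure K e) {\<omega>. return_word e \<omega> = w}"
  proof (rule emeasure_mono)
    show "{\<omega>. return_word e \<omega> = w} \<in> sets (markov_measure K e)"
      using measurable_sets[OF return_word_measurable, of "{w}" e K e] by (simp add: vimage_def)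
    show "{\<omega>. \<forall>i\<le>n. \<omega> i = x i} \<subseteq> {\<omega>. return_word e \<omega> = w}"
    proof
      fix \<omega> assume "\<omega> \<in> {\<omega>. \<forall>i\<le>n. \<omega> i = x i}"
      then have eq: "\<And>i. i \<le> n \<Longrightarrow> \<omega> i = x i" by simp
      then have "map \<omega> [0..<n] = map x [0..<n]" by auto
      with eq n xn xk word show "\<omega> \<in> {\<omega>. return_word e \<omega> = w}"
        using return_word_eq_iff[OF ne, of e \<omega>] return_time_eqI[of n \<omega> e] by (simp add: n_def del: map_eq_conv)
    qed
  qed
  finally show ?thesis .
qed

section \<open>Zariski closures in matrix groups\<close>

lemma coset_eq_image: "a <#\<^bsub>G\<^esub> H #>\<^bsub>G\<^esub> b = (\<lambda>h. a \<otimes>\<^bsub>G\<^esub> h \<otimes>\<^bsub>G\<^esub> b) ` H"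
  by (auto simp: l_coset_def r_coset_def)

lemma (in group) inv_mult_cancel:
  assumes "x \<in> carrier G" "y \<in> carrier G"
  shows "inv x \<otimes> (x \<otimes> y) = y" "x \<otimes> (inv x \<otimes> y) = y"
  using assms by (simp_all flip: m_assoc)

text \<open>Inserting the identity puts \<open>a \<otimes> b\<close> in \<open>H\<close> and
  \<open>b \<otimes> a\<close> in \<open>H'\<close>. Multiplying by the inverses of these elements
  turns both two-sided translates into conjugates by \<open>b\<close> or its inverse.\<close>

lemma (in group) conjugate_eq_if_absorbs:
  assumes H: "subgroup H G" and H': "subgroup H' G" and a: "a \<in> carrier G" and b: "b \<in> carrier G"
    and aH'b: "\<And>h. h \<in> H' \<Longrightarrow> a \<otimes> h \<otimes> b \<in> H" and bHa: "\<And>h. h \<in> H \<Longrightarrow> b \<otimes> h \<otimes> a \<in> H'"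
  shows "inv b <# H' #> b = H"
  unfolding coset_eq_image
proof (intro subset_antisym subsetI)
  have ab: "a \<otimes> b \<in> H"
    using aH'b[OF subgroup.one_closed[OF H']] a b by simp
  fix x assume "x \<in> (\<lambda>h. inv b \<otimes> h \<otimes> b) ` H'"
  then obtain h where h: "h \<in> H'" "x = inv b \<otimes> h \<otimes> b" by blast
  then have "h \<in> carrier G" using subgroup.subset[OF H'] by blast
  then have "x = inv (a \<otimes> b) \<otimes> (a \<otimes> h \<otimes> b)"
    using a b h by (simp add: inv_mult_group m_assoc inv_mult_cancel)
  then show "x \<in> H"
    using subgroup.m_closed[OF H subgroup.m_inv_closed[OF H ab] aH'b[OF h(1)]] by simp
next
  have ba: "b \<otimes> a \<in> H'"
    using bHa[OF subgroup.one_closed[OF H]] a b by simp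
  fix h assume h: "h \<in> H"
  then have hG: "h \<in> carrier G" using subgroup.subset[OF H] by blast
  have "b \<otimes> h \<otimes> a \<otimes> inv (b \<otimes> a) \<in> H'"
    by (intro subgroup.m_closed[OF H'] subgroup.m_inv_closed[OF H'] ba bHa h)
  moreover have "inv b \<otimes> (b \<otimes> h \<otimes> a \<otimes> inv (b \<otimes> a)) \<otimes> b = h"
  proof -
    have "b \<otimes> h \<otimes> a \<otimes> inv (b \<otimes> a) = b \<otimes> (h \<otimes> inv b)"
      using a b hG by (simp add: inv_mult_group m_assoc inv_mult_cancel)
    then show ?thesis
      using a b hG by (simp add: m_assoc inv_mult_cancel)
  qed
  ultimately show "h \<in> (\<lambda>h. inv b \<otimes> h \<otimes> b) ` H'"
    by (metis (lifting) image_eqI)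
qed

lemma (in group) conjugate_swap:
  assumes "H' \<subseteq> carrier G" "a \<in> carrier G" "inv a <# H' #> a = H"
  shows "a <# H #> inv a = H'"
proof -
  have "(\<lambda>h. a \<otimes> (inv a \<otimes> h \<otimes> a) \<otimes> inv a) ` H' = (\<lambda>h. h) ` H'"
  proof (rule image_cong[OF refl])
    fix h assume "h \<in> H'"
    then have "h \<in> carrier G" using assms by blast
    with assms(2) show "a \<otimes> (inv a \<otimes> h \<otimes> a) \<otimes> inv a = h"
      by (simp add: m_assoc inv_mult_cancel)
  qed
  then show ?thesis
    using assms(3) by (auto simp: coset_eq_image image_image)
qed

section \<open>Zariski closures of semigroups and normalizers\<close>

locale matrix_group = group G for G :: "('a, 'b) monoid_scheme" (structure) +
  fixes \<rho> :: "'a \<Rightarrow> real^'d^'d"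
  assumes hom: "\<rho> \<in> hom G GL"
begin

abbreviation zcl where "zcl \<equiv> zariski_closure \<rho> (carrier G)"

lemma rho_mult: "x \<in> carrier G \<Longrightarrow> y \<in> carrier G \<Longrightarrow> \<rho> (x \<otimes> y) = \<rho> x ** \<rho> y"
  using hom by (auto simp: hom_def GL_def)

lemma rho_one: "\<rho> \<one> = mat 1"
proof -
  \<comment> \<open>\<open>hom\<close> records multiplicativity; an invertible idempotent matrix is
    the identity.\<close>
  have "invertible (\<rho> \<one>)" and "\<rho> \<one> ** \<rho> \<one> = \<rho> \<one>"
    using hom rho_mult[of \<one> \<one>] by (auto simp: hom_def GL_def)
  then show ?thesis
    by (metis invertible_def matrix_mul_assoc matrix_mul_lid)
qed

lemma rho_inv: "x \<in> carrier G \<Longrightarrow> \<rho> x ** \<rho> (inv x) = mat 1"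
  by (metis inv_closed r_inv rho_mult rho_one)

text \<open>Each polynomial vanishing on \<open>S\<close> cuts out a closed set containing
  \<open>S\<close>, and every closed set containing \<open>S\<close> is an intersection of such sets
  inside the carrier.\<close>

lemma mem_zariski_closure:
  assumes "S \<subseteq> carrier G"
  shows "x \<in> zcl S \<longleftrightarrow> x \<in> carrier G \<and>
    (\<forall>p. real_polynomial_function p \<longrightarrow> (\<forall>s\<in>S. p (\<rho> s) = 0) \<longrightarrow> p (\<rho> x) = 0)"
proof (intro iffI conjI allI impI)
  assume x: "x \<in> zcl S"
  have "zariski_closed \<rho> (carrier G) (carrier G)"
    unfolding zariski_closed_def by (intro exI[of _ "{}"]) auto
  with x assms show "x \<in> carrier G"
    by (auto simp: zariski_closure_def)
  fix p assume p: "real_polynomial_function p" "\<forall>s\<in>S. p (\<rho> s) = 0"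
  let ?C = "{x\<in>carrier G. \<forall>q\<in>{p}. q (\<rho> x) = 0}"
  have "zariski_closed \<rho> (carrier G) ?C"
    unfolding zariski_closed_def using p(1) by (intro exI[of _ "{p}"]) auto
  moreover have "S \<subseteq> ?C" using p(2) assms by auto
  ultimately have "x \<in> ?C"
    using x unfolding zariski_closure_def by blast
  then show "p (\<rho> x) = 0" by simp
next
  assume x: "x \<in> carrier G \<and>
    (\<forall>p. real_polynomial_function p \<longrightarrow> (\<forall>s\<in>S. p (\<rho> s) = 0) \<longrightarrow> p (\<rho> x) = 0)"
  show "x \<in> zcl S"
    unfolding zariski_closure_def
  proof (rule InterI)
    fix C assume "C \<in> {C. zariski_closed \<rho> (carrier G) C \<and> S \<subseteq> C}"
    then obtain P where "\<forall>p\<in>P. real_polynomial_function p" "C = {x\<in>carrier G. \<forall>p\<in>P. p (\<rho> x) = 0}"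
      and "S \<subseteq> C"
      by (auto simp: zariski_closed_def)
    with x show "x \<in> C" by fast
  qed
qed

lemma zariski_closure_in_carrier: "S \<subseteq> carrier G \<Longrightarrow> zcl S \<subseteq> carrier G"
  using mem_zariski_closure by blast

lemma subset_zariski_closure: "S \<subseteq> zcl S"
  by (auto simp: zariski_closure_def)

text \<open>Zariski continuity of \<open>F\<close> is phrased through zero sets rather than through
  \<open>p\<close> composed with \<open>F\<close>, so that conjugation qualifies after its
  denominator is cleared.\<close>

lemma zariski_closure_map:
  assumes S: "S \<subseteq> carrier G" and S': "S' \<subseteq> carrier G"
    and F: "\<And>x. x \<in> carrier G \<Longrightarrow> F x \<in> carrier G"
    and q: "\<And>p. real_polynomial_function p \<Longrightarrow> \<exists>q. real_polynomial_function q \<and>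
      (\<forall>x\<in>carrier G. q (\<rho> x) = 0 \<longleftrightarrow> p (\<rho> (F x)) = 0)"
    and FS: "\<And>s. s \<in> S \<Longrightarrow> F s \<in> zcl S'" and x: "x \<in> zcl S"
  shows "F x \<in> zcl S'"
  unfolding mem_zariski_closure[OF S']
proof (intro conjI allI impI)
  have xG: "x \<in> carrier G"
    using x zariski_closure_in_carrier[OF S] by blast
  then show "F x \<in> carrier G" by (rule F)
  fix p assume p: "real_polynomial_function p" "\<forall>s\<in>S'. p (\<rho> s) = 0"
  obtain q where q: "real_polynomial_function q" "\<And>x. x \<in> carrier G \<Longrightarrow> q (\<rho> x) = 0 \<longleftrightarrow> p (\<rho> (F x)) = 0"
    using q[OF p(1)] by blast
  have "q (\<rho> s) = 0" if "s \<in> S" for s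
    using FS[OF that] p q(2)[of s] S that unfolding mem_zariski_closure[OF S'] by blast
  then have "q (\<rho> x) = 0"
    using x q(1) unfolding mem_zariski_closure[OF S] by blast
  then show "p (\<rho> (F x)) = 0"
    using q(2) xG by blast
qed

text \<open>Two-sided translation is linear in the matrix and so pulls polynomials back to
  polynomials.\<close>

lemma zariski_closure_two_sided:
  assumes S: "S \<subseteq> carrier G" and S': "S' \<subseteq> carrier G" and a: "a \<in> carrier G" and b: "b \<in> carrier G"
    and aSb: "\<And>s. s \<in> S \<Longrightarrow> a \<otimes> s \<otimes> b \<in> zcl S'" and x: "x \<in> zcl S"
  shows "a \<otimes> x \<otimes> b \<in> zcl S'"
proof (rule zariski_closure_map[OF S S' _ _ aSb x])
  fix p :: "real^'d^'d \<Rightarrow> real" assume p: "real_polynomial_function p"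
  have "polynomial_function (\<lambda>M. \<rho> a ** M ** \<rho> b)"
    by (intro polynomial_function_matrix_mult) auto
  then have "real_polynomial_function (\<lambda>M. p (\<rho> a ** M ** \<rho> b))"
    using real_polynomial_function_compose[OF _ p] by (simp add: o_def)
  then show "\<exists>q. real_polynomial_function q \<and>
      (\<forall>x\<in>carrier G. q (\<rho> x) = 0 \<longleftrightarrow> p (\<rho> (a \<otimes> x \<otimes> b)) = 0)"
    using a b by (intro exI conjI) (auto simp: rho_mult)
qed (use a b in auto)

lemma zariski_closure_least:
  assumes "S \<subseteq> zcl S'" "S' \<subseteq> carrier G"
  shows "zcl S \<subseteq> zcl S'"
proof
  fix x assume "x \<in> zcl S"
  then show "x \<in> zcl S'"
    using zariski_closure_two_sided[of S S' \<one> \<one> x] assms zariski_closure_in_carrier[OF assms(2)]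
      zariski_closure_in_carrier[of S] by (simp add: subset_iff)
qed

lemma zariski_closure_mono: "S \<subseteq> S' \<Longrightarrow> S' \<subseteq> carrier G \<Longrightarrow> zcl S \<subseteq> zcl S'"
  using zariski_closure_least subset_zariski_closure by blast

text \<open>Two passes: left translation by \<open>s \<in> S\<close> extends the second factor to
  the closure, then right translation by \<open>y\<close> extends the first.\<close>

lemma zariski_closure_semigroup_closed:
  assumes S: "S \<subseteq> carrier G" and SS: "\<And>s t. s \<in> S \<Longrightarrow> t \<in> S \<Longrightarrow> s \<otimes> t \<in> S"
    and x: "x \<in> zcl S" and y: "y \<in> zcl S"
  shows "x \<otimes> y \<in> zcl S"
proof -
  have yG: "y \<in> carrier G" using y zariski_closure_in_carrier[OF S] by blast
  have sy: "s \<otimes> y \<in> zcl S" if s: "s \<in> S" for s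
  proof -
    have sG: "s \<in> carrier G" using s S by blast
    have "s \<otimes> t \<otimes> \<one> \<in> zcl S" if "t \<in> S" for t
      using SS[OF s that] subset_zariski_closure S sG that by (auto simp: subset_iff)
    from zariski_closure_two_sided[OF S S sG one_closed this y] show ?thesis
      using sG yG by simp
  qed
  have "\<one> \<otimes> s \<otimes> y \<in> zcl S" if "s \<in> S" for s
    using sy[OF that] S that by (auto simp: subset_iff)
  from zariski_closure_two_sided[OF S S one_closed yG this x] show ?thesis
    using x zariski_closure_in_carrier[OF S] by (auto simp: subset_iff)
qed

lemma subgroup_zariski_closure:
  assumes S: "S \<subseteq> carrier G" and ne: "S \<noteq> {}" and SS: "\<And>s t. s \<in> S \<Longrightarrow> t \<in> S \<Longrightarrow> s \<otimes> t \<in> S"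
  shows "subgroup (zcl S) G"
proof -
  note zG = zariski_closure_in_carrier[OF S]
  have zm: "x \<otimes> y \<in> zcl S" if "x \<in> zcl S" "y \<in> zcl S" for x y
    by (rule zariski_closure_semigroup_closed[OF S SS that])
  \<comment> \<open>Taking \<open>y = x\<close> gives the identity and \<open>y = \<one>\<close> the
    inverses. The polynomial \<open>p\<close> vanishes on the forward orbit of
    \<open>\<rho> y\<close> under multiplication by \<open>\<rho> x\<close>, hence also one step
    backward.\<close>
  have div: "inv x \<otimes> y \<in> zcl S" if x: "x \<in> zcl S" and y: "y \<in> zcl S" for x y
    unfolding mem_zariski_closure[OF S]
  proof (intro conjI allI impI)
    have xG: "x \<in> carrier G" and yG: "y \<in> carrier G" using x y zG by auto
    then show "inv x \<otimes> y \<in> carrier G" by simp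
    fix p assume p: "real_polynomial_function p" "\<forall>s\<in>S. p (\<rho> s) = 0"
    let ?L = "\<lambda>M. \<rho> x ** M"
    have "\<exists>z\<in>zcl S. (?L ^^ k) (\<rho> y) = \<rho> z" for k
    proof (induction k)
      case 0
      then show ?case using y by auto
    next
      case (Suc k)
      then obtain z where "z \<in> zcl S" "(?L ^^ k) (\<rho> y) = \<rho> z" by blast
      then show ?case
        using zm[OF x, of z] rho_mult[OF xG, of z] zG by (auto intro!: bexI[of _ "x \<otimes> z"])
    qed
    then have "p ((?L ^^ k) (\<rho> y)) = 0" for k
      using p mem_zariski_closure[OF S] by metis
    moreover have "linear ?L"
      by (rule linearI) (simp_all add: matrix_add_ldistrib matrix_scalar_ac scalar_mult_eq_scaleR
          vec_eq_iff matrix_matrix_mult_def sum_distrib_left algebra_simps sum.distrib)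
    ultimately have "p (\<rho> (inv x) ** \<rho> y) = 0"
      using polynomial_vanishes_on_backward_orbit[OF p(1), of ?L "\<lambda>M. \<rho> (inv x) ** M" "\<rho> y"] rho_inv[OF xG]
      by (simp add: matrix_mul_assoc)
    then show "p (\<rho> (inv x \<otimes> y)) = 0"
      using xG yG by (simp add: rho_mult)
  qed
  obtain s where s: "s \<in> zcl S" using ne subset_zariski_closure by blast
  have one: "\<one> \<in> zcl S"
    using div[OF s s] s zG by auto
  have "inv x \<in> zcl S" if "x \<in> zcl S" for x
    using div[OF that one] that zG by auto
  with zG zm one show ?thesis
    by (auto intro!: subgroup.intro)
qed

lemma zariski_closure_subset_normalizer:
  assumes H: "subgroup (zcl S) G" and S: "S \<subseteq> carrier G" and R: "R \<subseteq> carrier G"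
    and conj: "\<And>r h. r \<in> R \<Longrightarrow> h \<in> zcl S \<Longrightarrow> r \<otimes> h \<otimes> inv r \<in> zcl S"
  shows "zcl R \<subseteq> normalizer G (zcl S)"
proof -
  let ?Z = "{x\<in>carrier G. \<forall>h\<in>zcl S. x \<otimes> h \<otimes> inv x \<in> zcl S}"
  have ZG: "?Z \<subseteq> carrier G" by auto
  note HG = subgroup.subset[OF H]
  \<comment> \<open>\<open>?Z\<close> is a Zariski closed semigroup, hence a group, which upgrades inclusion of conjugates
    to equality.\<close>
  have closed: "zcl ?Z \<subseteq> ?Z"
  proof
    fix x assume x: "x \<in> zcl ?Z"
    then have xG: "x \<in> carrier G" using zariski_closure_in_carrier[OF ZG] by blast
    \<comment> \<open>For fixed \<open>h\<close> this is a rational condition on \<open>x\<close>;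
      as determinants do not vanish on the group, the cleared polynomial has the same zeros
      there.\<close>
    have "x \<otimes> h \<otimes> inv x \<in> zcl S" if h: "h \<in> zcl S" for h
    proof (rule zariski_closure_map[OF ZG S _ _ _ x, where F = "\<lambda>x. x \<otimes> h \<otimes> inv x"])
      fix p :: "real^'d^'d \<Rightarrow> real" assume "real_polynomial_function p"
      then obtain k q where q: "real_polynomial_function q"
        "\<And>M N. M ** N = mat 1 \<Longrightarrow> q M = det M ^ k * p (M ** \<rho> h ** N)"
        using conjugation_clear_denominator by metis
      have "q (\<rho> x) = 0 \<longleftrightarrow> p (\<rho> (x \<otimes> h \<otimes> inv x)) = 0" if "x \<in> carrier G" for x
      proof -
        have "det (\<rho> x) \<noteq> 0"
          using rho_inv[OF that] by (metis det_I det_mul mult_zero_left zero_neq_one)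
        then show ?thesis
          using q(2)[OF rho_inv[OF that]] that h HG by (auto simp: rho_mult subset_iff)
      qed
      with q(1) show "\<exists>q. real_polynomial_function q \<and>
          (\<forall>x\<in>carrier G. q (\<rho> x) = 0 \<longleftrightarrow> p (\<rho> (x \<otimes> h \<otimes> inv x)) = 0)"
        by blast
    qed (use h HG in auto)
    with xG show "x \<in> ?Z" by blast
  qed
  then have Zeq: "zcl ?Z = ?Z"
    using subset_zariski_closure[of ?Z] by (rule subset_antisym)
  have "x \<otimes> y \<in> ?Z" if "x \<in> ?Z" "y \<in> ?Z" for x y
  proof -
    have "x \<otimes> y \<otimes> h \<otimes> inv (x \<otimes> y) = x \<otimes> (y \<otimes> h \<otimes> inv y) \<otimes> inv x" if "h \<in> zcl S" for h
      using \<open>x \<in> ?Z\<close> \<open>y \<in> ?Z\<close> that HG by (auto simp: inv_mult_group m_assoc subset_iff)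
    then show ?thesis using that by auto
  qed
  moreover have "\<one> \<in> ?Z"
    using HG by (auto simp: subset_iff)
  ultimately have "subgroup (zcl ?Z) G"
    by (intro subgroup_zariski_closure ZG) auto
  then have Zsub: "subgroup ?Z G" unfolding Zeq .
  have "?Z \<subseteq> normalizer G (zcl S)"
  proof
    fix x assume x: "x \<in> ?Z"
    have xG: "x \<in> carrier G" and ix: "inv x \<in> ?Z"
      using x subgroup.m_inv_closed[OF Zsub x] by auto
    have "h \<in> (\<lambda>h. x \<otimes> h \<otimes> inv x) ` zcl S" if h: "h \<in> zcl S" for h
    proof (rule image_eqI)
      show "inv x \<otimes> h \<otimes> x \<in> zcl S"
        using ix h xG by auto
      have "h \<in> carrier G" using h HG by blast
      with xG show "h = x \<otimes> (inv x \<otimes> h \<otimes> x) \<otimes> inv x"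
        by (simp add: m_assoc inv_mult_cancel)
    qed
    then have "x <# zcl S #> inv x = zcl S"
      using x by (auto simp: coset_eq_image)
    with xG HG show "x \<in> normalizer G (zcl S)"
      by (simp add: normalizer_def stabilizer_def)
  qed
  moreover have "R \<subseteq> ?Z" using R conj by auto
  then have "zcl R \<subseteq> ?Z"
    using zariski_closure_mono[of R ?Z] ZG unfolding Zeq by simp
  ultimately show ?thesis by blast
qed

end

section \<open>Renewal semigroups\<close>

context lie_group
begin

lemma continuous_mult: "continuous_map (prod_topology T T) T (\<lambda>(x, y). x \<otimes> y)"
  using smooth_mult by (simp add: smooth_map_def)

lemma continuous_two_sided:
  assumes "a \<in> carrier G" "b \<in> carrier G"
  shows "continuous_map T T (\<lambda>x. a \<otimes> x \<otimes> b)"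
proof -
  have a: "continuous_map T T (\<lambda>x. a \<otimes> x)"
    using continuous_map_compose[OF _ continuous_mult, of T "\<lambda>x. (a, x)"] assms
    by (simp add: o_def continuous_map_pairwise topspace_eq)
  then show ?thesis
    using continuous_map_compose[OF _ continuous_mult, of T "\<lambda>x. (a \<otimes> x, b)"] assms
    by (simp add: o_def continuous_map_pairwise topspace_eq)
qed

text \<open>Multiplication is jointly continuous, and the closure of \<open>S \<times> S\<close> is
  the product of the closures.\<close>

lemma closure_semigroup_closed:
  assumes "\<And>s t. s \<in> S \<Longrightarrow> t \<in> S \<Longrightarrow> s \<otimes> t \<in> S"
    and "x \<in> T closure_of S" "y \<in> T closure_of S"
  shows "x \<otimes> y \<in> T closure_of S"
proof -
  have "(\<lambda>(x, y). x \<otimes> y) ` (prod_topology T T closure_of (S \<times> S))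
      \<subseteq> T closure_of ((\<lambda>(x, y). x \<otimes> y) ` (S \<times> S))"
    by (rule continuous_map_image_closure_subset[OF continuous_mult])
  also have "\<dots> \<subseteq> T closure_of S"
    using assms(1) by (intro closure_of_mono) auto
  finally show ?thesis
    using assms(2,3) by (auto simp: closure_of_Times)
qed

end

section \<open>Products along words and the support of the renewal measure\<close>

lemma (in group) word_prod_closed:
  assumes "\<And>f. g f \<in> carrier G"
  shows "word_prod G g w \<in> carrier G"
  using assms by (induction w) (auto simp: word_prod_def)

lemma (in group) word_prod_append:
  assumes "\<And>f. g f \<in> carrier G"
  shows "word_prod G g (u @ v) = word_prod G g u \<otimes> word_prod G g v"
proof (induction u)
  case Nil
  show ?case using word_prod_closed[of g v] assms by (simp add: word_prod_def)
next
  case (Cons x u)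
  have "word_prod G g (x # w) = g x \<otimes> word_prod G g w" for w
    by (simp add: word_prod_def)
  with Cons show ?case
    using assms word_prod_closed[of g] by (simp add: m_assoc)
qed

definition loop_products ::
  "('a, 'b) monoid_scheme \<Rightarrow> ('e \<Rightarrow> 'a) \<Rightarrow> ('e \<Rightarrow> 'e pmf) \<Rightarrow> 'e \<Rightarrow> 'a set" where
  "loop_products G g K e = {word_prod G g w | w. admissible_between K e e w}"

locale coded_chain = lie_group G T n A
  for G :: "('a, 'b) monoid_scheme" (structure) and T n A +
  fixes g :: "'e::countable \<Rightarrow> 'a" and K :: "'e \<Rightarrow> 'e pmf"
  assumes g_closed: "\<And>f. g f \<in> carrier G"
    and irreducible: "irreducible_chain K" and recurrent: "recurrent_chain K"
begin

abbreviation "W \<equiv> word_prod G g"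
abbreviation "R \<equiv> loop_products G g K"

lemma W_closed: "W w \<in> carrier G"
  by (rule word_prod_closed[OF g_closed])

lemma W_append: "W (u @ v) = W u \<otimes> W v"
  by (rule word_prod_append[OF g_closed])

lemma R_closed: "R e \<subseteq> carrier G"
  by (auto simp: loop_products_def W_closed)

lemma R_nonempty: "R e \<noteq> {}"
  using admissible_between_exists[OF irreducible, of e e] by (simp add: loop_products_def)

lemma R_mult: "x \<in> R e \<Longrightarrow> y \<in> R e \<Longrightarrow> x \<otimes> y \<in> R e"
  by (auto simp: loop_products_def simp flip: W_append intro: admissible_between_trans)

lemma R_conjugate:
  assumes "admissible_between K e' e c" "admissible_between K e e' c'" "x \<in> R e'"
  shows "W c' \<otimes> x \<otimes> W c \<in> R e"
proof -
  obtain w where "x = W w" "admissible_between K e' e' w"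
    using assms(3) by (auto simp: loop_products_def)
  then have "W c' \<otimes> x \<otimes> W c = W (c' @ w @ c)" "admissible_between K e e (c' @ w @ c)"
    using assms(1,2) by (auto simp: W_append W_closed m_assoc intro: admissible_between_trans)
  then show ?thesis
    by (auto simp: loop_products_def)
qed

text \<open>Words carry the discrete sigma-algebra, so \<open>W\<close> is measurable and masses of
  open sets can be computed on path space.\<close>

lemma emeasure_renewal_measure:
  assumes "openin T U"
  shows "emeasure (renewal_measure G T g K e) U =
      emeasure (markov_measure K e) {\<omega>. W (return_word e \<omega>) \<in> U}"
    and "{\<omega>. W (return_word e \<omega>) \<in> U} \<in> sets (markov_measure K e)"
proof -
  let ?B = "sigma (topspace T) {U. openin T U}"
  have sub: "{U. openin T U} \<subseteq> Pow (topspace T)"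
    using openin_subset by auto
  have "W \<in> count_space UNIV \<rightarrow>\<^sub>M ?B"
    using W_closed sub by (simp add: space_measure_of topspace_eq)
  from measurable_compose[OF return_word_measurable this]
  have meas: "(\<lambda>\<omega>. W (return_word e \<omega>)) \<in> markov_measure K e \<rightarrow>\<^sub>M ?B" .
  have U: "U \<in> sets ?B"
    using sub assms by (auto simp: sets_measure_of)
  show "emeasure (renewal_measure G T g K e) U =
      emeasure (markov_measure K e) {\<omega>. W (return_word e \<omega>) \<in> U}"
    unfolding renewal_measure_def by (subst emeasure_distr[OF meas U]) (simp add: vimage_def)
  show "{\<omega>. W (return_word e \<omega>) \<in> U} \<in> sets (markov_measure K e)"
    using measurable_sets[OF meas U] by (simp add: vimage_def)
qed

text \<open>Every neighbourhood of a support point has positive mass, while by recurrence almost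
  every return word is a loop; so the neighbourhood contains a loop product.\<close>

lemma support_subset: "topological_support T (renewal_measure G T g K e) \<subseteq> T closure_of R e"
proof
  fix x assume x: "x \<in> topological_support T (renewal_measure G T g K e)"
  show "x \<in> T closure_of R e"
    unfolding in_closure_of
  proof (intro conjI allI impI)
    show "x \<in> topspace T" using x by (simp add: topological_support_def)
    fix U assume U: "x \<in> U \<and> openin T U"
    then have "emeasure (markov_measure K e) {\<omega>. W (return_word e \<omega>) \<in> U} > 0"
      using x by (auto simp: topological_support_def emeasure_renewal_measure(1)[symmetric])
    from AE_imp_ex_in_positive_set[OF AE_return_word_admissible[OF recurrent]
        emeasure_renewal_measure(2) this] U
    show "\<exists>y. y \<in> R e \<and> y \<in> U"
      by (auto simp: loop_products_def)
  qed
qed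

lemma first_return_in_support:
  assumes "admissible_between K e e w" "\<And>u v. w = u @ v \<Longrightarrow> u \<noteq> [] \<Longrightarrow> v \<noteq> [] \<Longrightarrow> last u \<noteq> e"
  shows "W w \<in> topological_support T (renewal_measure G T g K e)"
  unfolding topological_support_def
proof (intro CollectI conjI allI impI)
  show "W w \<in> topspace T" by (simp add: topspace_eq W_closed)
  fix U assume U: "openin T U \<and> W w \<in> U"
  have "0 < emeasure (markov_measure K e) {\<omega>. return_word e \<omega> = w}"
    using assms by (rule first_return_word_positive)
  also have "\<dots> \<le> emeasure (markov_measure K e) {\<omega>. W (return_word e \<omega>) \<in> U}"
    using U by (intro emeasure_mono emeasure_renewal_measure(2)) auto
  finally show "0 < emeasure (renewal_measure G T g K e) U"
    using U by (simp add: emeasure_renewal_measure(1))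
qed

lemma renewal_semigroup_eq: "renewal_semigroup G T g K e = T closure_of R e"
proof
  have "closed_subsemigroup G T (T closure_of R e)"
    unfolding closed_subsemigroup_def
    using closure_semigroup_closed[OF R_mult] by auto
  then show "renewal_semigroup G T g K e \<subseteq> T closure_of R e"
    unfolding renewal_semigroup_def using support_subset by blast
  show "T closure_of R e \<subseteq> renewal_semigroup G T g K e"
    unfolding renewal_semigroup_def
  proof (rule Inter_greatest)
    fix S assume "S \<in> {S. closed_subsemigroup G T S \<and>
        topological_support T (renewal_measure G T g K e) \<subseteq> S}"
    then have S: "closedin T S" "\<And>x y. x \<in> S \<Longrightarrow> y \<in> S \<Longrightarrow> x \<otimes> y \<in> S"
        "topological_support T (renewal_measure G T g K e) \<subseteq> S"
      by (auto simp: closed_subsemigroup_def)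
    \<comment> \<open>Strong induction on the length: a cut at a visit to \<open>e\<close> leaves
      two shorter loops; without one, \<open>w\<close> is a first-return word and its product lies
      in the support.\<close>
    have "W w \<in> S" if "admissible_between K e e w" for w
      using that
    proof (induction w rule: length_induct)
      case (1 w)
      show ?case
      proof (cases "\<exists>u v. w = u @ v \<and> u \<noteq> [] \<and> v \<noteq> [] \<and> last u = e")
        case True
        then obtain u v where w: "w = u @ v" "u \<noteq> []" "v \<noteq> []" "last u = e" by blast
        then have "admissible_between K e e u" "admissible_between K e e v"
          using 1(2) admissible_between_append by metis+
        moreover have "length u < length w" "length v < length w"
          using w by auto
        ultimately show ?thesis
          using 1(1) S(2) by (simp add: w(1) W_append)
      next
        case False
        then show ?thesis
          using first_return_in_support[OF 1(2)] S(3) by blast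
      qed
    qed
    then have "R e \<subseteq> S" by (auto simp: loop_products_def)
    then show "T closure_of R e \<subseteq> S"
      using S(1) by (rule closure_of_minimal)
  qed
qed

lemma renewal_semigroup_absorbs:
  assumes "admissible_between K e' e c" "admissible_between K e e' c'"
  shows "W c' <# renewal_semigroup G T g K e' #> W c \<subseteq> renewal_semigroup G T g K e"
proof -
  have "(\<lambda>x. W c' \<otimes> x \<otimes> W c) ` (T closure_of R e') \<subseteq> T closure_of ((\<lambda>x. W c' \<otimes> x \<otimes> W c) ` R e')"
    by (intro continuous_map_image_closure_subset continuous_two_sided W_closed)
  also have "\<dots> \<subseteq> T closure_of R e"
    using R_conjugate[OF assms] by (intro closure_of_mono) auto
  finally show ?thesis
    by (simp add: coset_eq_image renewal_semigroup_eq)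
qed

end

section \<open>The algebraic groups of the chain\<close>

locale algebraic_coded_chain = coded_chain G T n A g K
  for G :: "('a, 'b) monoid_scheme" (structure) and T n A
    and g :: "'e::countable \<Rightarrow> 'a" and K :: "'e \<Rightarrow> 'e pmf" +
  fixes \<rho> :: "'a \<Rightarrow> real^'d^'d"
  assumes algebraic: "real_algebraic G T n A \<rho>"
begin

sublocale matrix_group G \<rho>
  using algebraic by unfold_locales (simp add: real_algebraic_def)

abbreviation "H \<equiv> H_state G T \<rho> g K"
abbreviation "H\<^sub>S \<equiv> H_system G \<rho> g K"

text \<open>Polynomials composed with \<open>\<rho>\<close> are continuous, so their zero sets are
  closed in \<open>T\<close>, and taking the topological closure first does not enlarge the Zariski
  closure.\<close>

lemma H_state_eq: "H e = zcl (R e)"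
proof
  have cont: "continuous_map T euclidean \<rho>"
    using algebraic unfolding real_algebraic_def embedding_map_def
    by (blast dest: homeomorphic_imp_continuous_map continuous_map_in_subtopology[THEN iffD1])
  have sub: "T closure_of R e \<subseteq> carrier G"
    using closure_of_subset_topspace[of T "R e"] by (simp add: topspace_eq)
  have "T closure_of R e \<subseteq> zcl (R e)"
  proof
    fix x assume x: "x \<in> T closure_of R e"
    show "x \<in> zcl (R e)"
      unfolding mem_zariski_closure[OF R_closed]
    proof (intro conjI allI impI)
      show "x \<in> carrier G" using x sub by blast
      fix p assume p: "real_polynomial_function p" "\<forall>s\<in>R e. p (\<rho> s) = 0"
      have "continuous_map euclidean euclideanreal p"
        using p(1) by (simp add: continuous_on_polymonial_function real_polynomial_function_eq)
      from continuous_map_compose[OF cont this]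
      have "continuous_map T euclideanreal (\<lambda>x. p (\<rho> x))"
        by (simp add: o_def)
      then have "closedin T {x\<in>topspace T. p (\<rho> x) \<in> {0}}"
        by (rule closedin_continuous_map_preimage) simp
      moreover have "R e \<subseteq> {x\<in>topspace T. p (\<rho> x) \<in> {0}}"
        using p(2) R_closed by (auto simp: topspace_eq)
      ultimately show "p (\<rho> x) = 0"
        using closure_of_minimal[of "R e" "{x\<in>topspace T. p (\<rho> x) \<in> {0}}" T] x by blast
    qed
  qed
  then show "H e \<subseteq> zcl (R e)"
    unfolding H_state_def renewal_semigroup_eq by (rule zariski_closure_least[OF _ R_closed])
  show "zcl (R e) \<subseteq> H e"
    unfolding H_state_def renewal_semigroup_eq
    using closure_of_subset[of "R e" T] R_closed sub by (intro zariski_closure_mono) (simp_all add: topspace_eq)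
qed

lemma subgroup_H: "subgroup (H e) G"
  unfolding H_state_eq by (intro subgroup_zariski_closure R_closed R_nonempty R_mult)

lemma H_absorbs:
  assumes "admissible_between K e' e c" "admissible_between K e e' c'" "h \<in> H e'"
  shows "W c' \<otimes> h \<otimes> W c \<in> H e"
  using assms(3) unfolding H_state_eq
  by (rule zariski_closure_two_sided[OF R_closed R_closed W_closed W_closed, rotated])
     (rule subsetD[OF subset_zariski_closure R_conjugate[OF assms(1,2)]])

text \<open>Irreducibility supplies a word \<open>c'\<close> in the opposite direction, so both
  groups absorb each other, with \<open>a = W c'\<close> and \<open>b = W c\<close>.\<close>

lemma H_conjugate:
  assumes "admissible_between K e' e c"
  shows "inv (W c) <# H e' #> W c = H e"
proof -
  obtain c' where "admissible_between K e e' c'"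
    using admissible_between_exists[OF irreducible] by blast
  with assms show ?thesis
    by (intro conjugate_eq_if_absorbs[OF subgroup_H subgroup_H W_closed[of c'] W_closed] H_absorbs)
qed

text \<open>This is \<open>H_conjugate\<close> with the two states exchanged, solved for the other
  group.\<close>

lemma H_conjugate':
  assumes "admissible_between K e e' c'"
  shows "W c' <# H e' #> inv (W c') = H e"
  using conjugate_swap[OF subgroup.subset[OF subgroup_H] W_closed H_conjugate[OF assms]] .

lemma admissible_products_closed: "admissible_products G g K \<subseteq> carrier G"
  by (auto simp: admissible_products_def W_closed)

lemma admissible_product_in_H_system: "admissible_between K a b w \<Longrightarrow> W w \<in> H\<^sub>S"
  unfolding H_system_def by (rule subsetD[OF subset_zariski_closure])
    (auto simp: admissible_products_def admissible_def)

lemma H_states_conjugate_in_H_system: "\<exists>h\<in>H\<^sub>S. h <# H e' #> inv h = H e"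
proof -
  obtain c where c: "admissible_between K e e' c"
    using admissible_between_exists[OF irreducible] by blast
  show ?thesis
    using H_conjugate'[OF c] admissible_product_in_H_system[OF c] by (rule bexI)
qed

lemma admissible_pair: "admissible K [a, b] \<Longrightarrow> admissible_between K a b [b]"
  by (auto simp: admissible_def admissible_between_Cons)

text \<open>Both groups arise from \<open>H d\<close> through conjugation by the product of the
  one-letter word \<open>[d]\<close>.\<close>

lemma H_eq_if_common_predecessor:
  assumes "admissible K [e, d]" "admissible K [e', d]"
  shows "H e = H e'"
  using H_conjugate'[OF admissible_pair[OF assms(1)]] H_conjugate'[OF admissible_pair[OF assms(2)]]
  by simp

text \<open>An admissible product conjugates some \<open>H b\<close> to some \<open>H a\<close>;
  when these coincide it normalizes the common group, and this passes to the Zariski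
  closure.\<close>

lemma H_system_subset_normalizer:
  assumes "\<And>f f'. H f = H f'"
  shows "H\<^sub>S \<subseteq> normalizer G (H f)"
  unfolding H_system_def H_state_eq
proof (rule zariski_closure_subset_normalizer[OF _ R_closed admissible_products_closed])
  show "subgroup (zcl (R f)) G"
    using subgroup_H[of f] by (simp add: H_state_eq)
  fix r h assume "r \<in> admissible_products G g K" and h: "h \<in> zcl (R f)"
  then obtain a b w where w: "r = W w" "admissible_between K a b w"
    by (auto simp: admissible_products_def admissible_def)
  from H_conjugate'[OF w(2)] h assms[of b f] assms[of a f]
  show "r \<otimes> h \<otimes> inv r \<in> zcl (R f)"
    by (auto simp: coset_eq_image w(1) H_state_eq)
qed

lemma H_eq_H_system:
  assumes d: "\<And>f. admissible K [d, f]"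
  shows "H f = H\<^sub>S"
proof -
  \<comment> \<open>Every state can step to \<open>d\<close>, so \<open>w\<close> can be given the
    target \<open>d\<close> without changing its letters.\<close>
  have to_d: "admissible_between K d b w" if "admissible_between K a b w" for a b w
    using that admissible_pair[OF d[of "hd w"]] by (simp add: admissible_between_def)
  \<comment> \<open>With \<open>u\<close> leading from \<open>d\<close> to \<open>b\<close>, both
    \<open>u\<close> and \<open>w @ u\<close> become loops at \<open>d\<close> after this change of
    target, and \<open>W w\<close> is a quotient of their products.\<close>
  have in_Hd: "W w \<in> H d" if w: "admissible_between K a b w" for a b w
  proof -
    obtain u where u: "admissible_between K b d u"
      using admissible_between_exists[OF irreducible] by blast
    have loop: "W v \<in> H d" if "admissible_between K d d v" for v
      using that subset_zariski_closure[of "R d"] unfolding H_state_eq by (auto simp: loop_products_def)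
    have "W u \<in> H d" "W w \<otimes> W u \<in> H d"
      using loop[OF to_d[OF u]] loop[OF admissible_between_trans[OF to_d[OF w] u]] by (auto simp: W_append)
    then have "W w \<otimes> W u \<otimes> inv (W u) \<in> H d"
      using subgroup_H[of d] by (blast intro: subgroup.m_closed subgroup.m_inv_closed)
    then show ?thesis
      by (simp add: m_assoc W_closed)
  qed
  have "H\<^sub>S \<subseteq> H d"
    unfolding H_system_def H_state_eq
    using in_Hd R_closed[of d]
    by (intro zariski_closure_least) (auto simp: admissible_products_def admissible_def H_state_eq)
  moreover have H_sub: "H f \<subseteq> H\<^sub>S" for f
    unfolding H_system_def H_state_eq
    by (intro zariski_closure_mono admissible_products_closed)
      (auto simp: loop_products_def admissible_products_def admissible_def)
  ultimately have Hd: "H d = H\<^sub>S" by blast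
  \<comment> \<open>The conjugating element from \<open>d\<close> to \<open>f\<close> lies in
    \<open>H d\<close> itself and so leaves \<open>H d\<close> unchanged.\<close>
  obtain c where c: "admissible_between K f d c"
    using admissible_between_exists[OF irreducible] by blast
  have "W c <# H d #> inv (W c) = H d"
    using in_Hd[OF c] subgroup_H[of d] by (simp add: coset_join2 coset_join3 W_closed subgroup.m_inv_closed)
  then show ?thesis
    using H_conjugate'[OF c] Hd by simp
qed

end

theorem lemma3p6:
  fixes G :: "('a, 'b) monoid_scheme" (structure)
    and T :: "'a topology" and n :: nat and A :: "'a atlas"
    and g :: "'e::countable \<Rightarrow> 'a" and K :: "'e \<Rightarrow> 'e pmf" and e e' :: 'e
  assumes "lie_group G T n A"
    and "\<forall>f. g f \<in> carrier G"
    and "irreducible_chain K" and "recurrent_chain K"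
  shows
    "(\<forall>c c'. admissible_between K e' e c \<and> admissible_between K e e' c' \<longrightarrow>
        word_prod G g c' <# renewal_semigroup G T g K e' #> word_prod G g c
          \<subseteq> renewal_semigroup G T g K e)
     \<and>
     (\<forall>\<rho> :: 'a \<Rightarrow> real^'d^'d. real_algebraic G T n A \<rho> \<longrightarrow>
        (subgroup (H_state G T \<rho> g K e) G \<and> subgroup (H_state G T \<rho> g K e') G \<and>
         (\<exists>h\<in>H_system G \<rho> g K.
            h <# H_state G T \<rho> g K e' #> inv\<^bsub>G\<^esub> h = H_state G T \<rho> g K e) \<and>
         (\<forall>c c'. admissible_between K e' e c \<and> admissible_between K e e' c' \<longrightarrow>
            word_prod G g c' <# H_state G T \<rho> g K e' #> inv\<^bsub>G\<^esub> (word_prod G g c')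
              = H_state G T \<rho> g K e \<and>
            inv\<^bsub>G\<^esub> (word_prod G g c) <# H_state G T \<rho> g K e' #> word_prod G g c
              = H_state G T \<rho> g K e))
        \<and>
        ((\<exists>d. admissible K [e, d] \<and> admissible K [e', d]) \<longrightarrow>
           H_state G T \<rho> g K e = H_state G T \<rho> g K e')
        \<and>
        ((\<exists>d. \<forall>f. admissible K [f, d]) \<longrightarrow>
           (\<forall>f f'. H_state G T \<rho> g K f = H_state G T \<rho> g K f') \<and>
           (\<forall>f. H_system G \<rho> g K \<subseteq> normalizer G (H_state G T \<rho> g K f)))
        \<and>
        ((\<exists>d. \<forall>f. admissible K [d, f]) \<longrightarrow>
           (\<forall>f. H_state G T \<rho> g K f = H_system G \<rho> g K) \<and>
           subgroup (H_system G \<rho> g K) G))"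
proof -
  interpret coded_chain G T n A g K
    using assms by (intro coded_chain.intro coded_chain_axioms.intro) auto
  \<comment> \<open>The map \<open>\<rho>\<close> is quantified inside the goal, so the facts of the
    algebraic locale are exported with \<open>\<rho>\<close> variable.\<close>
  have algebraic: "algebraic_coded_chain G T n A g K \<rho>" if "real_algebraic G T n A \<rho>"
    for \<rho> :: "'a \<Rightarrow> real^'d^'d"
    by (intro algebraic_coded_chain.intro algebraic_coded_chain_axioms.intro coded_chain_axioms that)
  note subgroup_H = algebraic_coded_chain.subgroup_H[OF algebraic]
    and conjugate = algebraic_coded_chain.H_states_conjugate_in_H_system[OF algebraic]
    and conjugate_c = algebraic_coded_chain.H_conjugate[OF algebraic]
    and conjugate_c' = algebraic_coded_chain.H_conjugate'[OF algebraic]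
    and common_predecessor = algebraic_coded_chain.H_eq_if_common_predecessor[OF algebraic]
    and normalizes = algebraic_coded_chain.H_system_subset_normalizer[OF algebraic]
    and eq_H_system = algebraic_coded_chain.H_eq_H_system[OF algebraic]
  \<comment> \<open>Case 1 is (i), cases 2 to 6 are (ii), case 7 is (iii), cases 8 and 9 are (iv),
    cases 10 and 11 are (v).\<close>
  show ?thesis
  proof (intro conjI allI impI, goal_cases)
    case (1 c c')
    then show ?case by (intro renewal_semigroup_absorbs) simp_all
  next
    case (2 \<rho>)
    then show ?case by (rule subgroup_H)
  next
    case (3 \<rho>)
    then show ?case by (rule subgroup_H)
  next
    case (4 \<rho>)
    then show ?case by (rule conjugate)
  next
    case (5 \<rho> c c')
    then show ?case by (intro conjugate_c'[OF 5(1)]) simp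
  next
    case (6 \<rho> c c')
    then show ?case by (intro conjugate_c[OF 6(1)]) simp
  next
    case (7 \<rho>)
    then show ?case using common_predecessor[OF 7(1)] by blast
  next
    case (8 \<rho> f f')
    then show ?case using common_predecessor[OF 8(1)] by blast
  next
    case (9 \<rho> f)
    then show ?case
      using common_predecessor[OF 9(1)] by (intro normalizes[OF 9(1)]) blast
  next
    case (10 \<rho> f)
    then show ?case using eq_H_system[OF 10(1)] by blast
  next
    case (11 \<rho>)
    then have "H_state G T \<rho> g K e = H_system G \<rho> g K"
      using eq_H_system[OF 11(1)] by blast
    then show ?case
      using subgroup_H[OF 11(1), of e] by simp
  qed
qed

end
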